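(* Let $p$ be a prime with $p\equiv 5 \pmod 8$, let $F=\mathbb{Q}(i)$, $K=\mathbb{Q}(i,\sqrt p)\subset\mathbb{C}$, let $\sigma$ be the generator of $\mathrm{Gal}(K/F)$ given by $\sqrt p\mapsto-\sqrt p$, and let $\gamma=i$. Then there exist a nonzero ideal $\mathcal{I}$ of $\mathcal{O}_K$ and a $\mathbb{Z}[i]$-basis $(\nu_1,\nu_2)$ of $\mathcal{I}$ such that the $2\times 2$ space-time code $\mathcal{C}(K/F,\sigma,\gamma,(\nu_k),c)$ with $c=p$ is perfect.
   Context: $\mathcal{O}_L$ denotes the ring of integers of a number field $L$. Code: let $F$ be $\mathbb{Q}(i)$ or $\mathbb{Q}(j)$ with $j=e^{2\pi i/3}$, $K\subset\mathbb{C}$ a cyclic extension of $F$ of degree $n$, $\sigma$ a generator of $\mathrm{Gal}(K/F)$, $\gamma\in F^*$, $(\nu_1,\dots,\nu_n)$ an $\mathcal{O}_F$-basis of a nonzero ideal of $\mathcal{O}_K$, and $c>0$ a real number. Given information symbols $u_{\ell,k}\in\mathcal{O}_F$ ($0\le \ell\le n-1$, $1\le k\le n$), put $x_\ell=\sum_{k=1}^n u_{\ell,k}\nu_k$. The infinite code $\mathcal{C}(K/F,\sigma,\gamma,(\nu_k),c)$ is the set of all $n\times n$ complex matrices $\frac{1}{\sqrt c}X$, where (indices $r,s\in\{0,\dots,n-1\}$) $X_{r,s}=\sigma^r(x_{s-r})$ if $s\ge r$ and $X_{r,s}=\gamma\,\sigma^r(x_{s-r+n})$ if $s<r$. The code is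 called perfect if: (1) (full rate) it encodes $n^2$ information symbols, i.e. the $\mathcal{O}_F$-independent symbols $u_{\ell,k}$ are determined by the codeword; (2) (non-vanishing determinant) there is $\delta>0$ such that $|\det \mathbf{X}|^2\ge\delta$ for every nonzero codeword $\mathbf{X}$ of the infinite code; (3) (shaping) the layer-encoding matrix $R=\frac{1}{\sqrt c}\big(\sigma^{r}(\nu_k)\big)_{0\le r\le n-1,\,1\le k\le n}$ is unitary; (4) (uniform average energy per antenna) $|\gamma|=1$. *)

theory Defs
  imports
    "HOL-Algebra.Bij"
    "HOL-Algebra.Embedded_Algebras"
    "HOL-Algebra.Generated_Fields"
    "HOL-Algebra.Algebraic_Closure_Type"
    "Jordan_Normal_Form.Determinant"
    "Jordan_Normal_Form.Schur_Decomposition"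
begin

section \<open>Subfields of the complex numbers\<close>

abbreviation complex_ring :: "complex ring" where
  "complex_ring \<equiv> ring_of_type_algebra"

text \<open>Since a subfield of the complex numbers contains the rationals, \<open>Q_adjoin S\<close> is
  the field obtained by adjoining \<open>S\<close> to the rationals.\<close>

definition Q_adjoin :: "complex set \<Rightarrow> complex set" where
  "Q_adjoin S = generate_field complex_ring S"

definition ring_of_integers :: "complex set \<Rightarrow> complex set" where
  "ring_of_integers L = {x \<in> L. algebraic_int x}"

definition nonzero_ideal :: "complex set \<Rightarrow> complex set \<Rightarrow> bool" where
  "nonzero_ideal I K \<longleftrightarrow>
     ideal I (complex_ring\<lparr>carrier := ring_of_integers K\<rparr>) \<and> I \<noteq> {0}"

text \<open>Bases are indexed by \<open>{..<n}\<close> rather than by \<open>1, \<dots>, n\<close>.\<close>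

definition integral_basis ::
    "complex set \<Rightarrow> nat \<Rightarrow> (nat \<Rightarrow> complex) \<Rightarrow> complex set \<Rightarrow> bool" where
  "integral_basis F n \<nu> I \<longleftrightarrow>
     I = {\<Sum>k<n. a k * \<nu> k | a. \<forall>k<n. a k \<in> ring_of_integers F} \<and>
     (\<forall>a. (\<forall>k<n. a k \<in> ring_of_integers F) \<longrightarrow> (\<Sum>k<n. a k * \<nu> k) = 0 \<longrightarrow>
          (\<forall>k<n. a k = 0))"


section \<open>Cyclic extensions\<close>

text \<open>As in \<^const>\<open>BijGroup\<close>, automorphisms of \<open>K\<close> are extensional functions, so that
  equality of group elements is equality on \<open>K\<close>.\<close>

definition galois_group :: "complex set \<Rightarrow> complex set \<Rightarrow> (complex \<Rightarrow> complex) monoid" where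
  "galois_group F K = (BijGroup K)\<lparr>carrier :=
     {\<sigma> \<in> Bij K. \<sigma> \<in> Ring.ring_hom (complex_ring\<lparr>carrier := K\<rparr>) (complex_ring\<lparr>carrier := K\<rparr>)
                \<and> (\<forall>x\<in>F. \<sigma> x = x)}\<rparr>"

definition galois_generator :: "complex set \<Rightarrow> complex set \<Rightarrow> (complex \<Rightarrow> complex) \<Rightarrow> bool" where
  "galois_generator F K \<sigma> \<longleftrightarrow>
     \<sigma> \<in> carrier (galois_group F K) \<and>
     generate (galois_group F K) {\<sigma>} = carrier (galois_group F K)"

definition galois_extension :: "complex set \<Rightarrow> complex set \<Rightarrow> nat \<Rightarrow> bool" where
  "galois_extension F K n \<longleftrightarrow>
     subfield F complex_ring \<and> subfield K complex_ring \<and> F \<subseteq> K \<and>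
     ring.dimension complex_ring n F K \<and>
     {x \<in> K. \<forall>\<tau> \<in> carrier (galois_group F K). \<tau> x = x} = F"

definition cyclic_extension :: "complex set \<Rightarrow> complex set \<Rightarrow> nat \<Rightarrow> bool" where
  "cyclic_extension F K n \<longleftrightarrow> galois_extension F K n \<and> (\<exists>\<tau>. galois_generator F K \<tau>)"


section \<open>Space-time codes from cyclic algebras\<close>

definition code_setting ::
    "complex set \<Rightarrow> complex set \<Rightarrow> nat \<Rightarrow> (complex \<Rightarrow> complex) \<Rightarrow> complex \<Rightarrow> real \<Rightarrow> bool" where
  "code_setting F K n \<sigma> \<gamma> c \<longleftrightarrow>
     (F = Q_adjoin {\<i>} \<or> F = Q_adjoin {exp (2 * of_real pi * \<i> / 3)}) \<and>
     cyclic_extension F K n \<and> galois_generator F K \<sigma> \<and> \<gamma> \<in> F \<and> \<gamma> \<noteq> 0 \<and> c > 0"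

definition info_symbols :: "complex set \<Rightarrow> nat \<Rightarrow> (nat \<times> nat \<Rightarrow> complex) set" where
  "info_symbols F n = {..<n} \<times> {..<n} \<rightarrow>\<^sub>E ring_of_integers F"

definition layer_element ::
    "nat \<Rightarrow> (nat \<Rightarrow> complex) \<Rightarrow> (nat \<times> nat \<Rightarrow> complex) \<Rightarrow> nat \<Rightarrow> complex" where
  "layer_element n \<nu> u l = (\<Sum>k<n. u (l, k) * \<nu> k)"

definition codeword ::
    "nat \<Rightarrow> (complex \<Rightarrow> complex) \<Rightarrow> complex \<Rightarrow> (nat \<Rightarrow> complex) \<Rightarrow> real
      \<Rightarrow> (nat \<times> nat \<Rightarrow> complex) \<Rightarrow> complex mat" where
  "codeword n \<sigma> \<gamma> \<nu> c u =
     complex_of_real (1 / sqrt c) \<cdot>\<^sub>m mat n n (\<lambda>(r, s).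
       if r \<le> s then (\<sigma> ^^ r) (layer_element n \<nu> u (s - r))
       else \<gamma> * (\<sigma> ^^ r) (layer_element n \<nu> u (s + n - r)))"

definition infinite_code ::
    "complex set \<Rightarrow> nat \<Rightarrow> (complex \<Rightarrow> complex) \<Rightarrow> complex \<Rightarrow> (nat \<Rightarrow> complex) \<Rightarrow> real
      \<Rightarrow> complex mat set" where
  "infinite_code F n \<sigma> \<gamma> \<nu> c = codeword n \<sigma> \<gamma> \<nu> c ` info_symbols F n"

definition layer_matrix ::
    "nat \<Rightarrow> (complex \<Rightarrow> complex) \<Rightarrow> (nat \<Rightarrow> complex) \<Rightarrow> real \<Rightarrow> complex mat" where
  "layer_matrix n \<sigma> \<nu> c =
     complex_of_real (1 / sqrt c) \<cdot>\<^sub>m mat n n (\<lambda>(r, k). (\<sigma> ^^ r) (\<nu> k))"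

definition unitary_mat :: "nat \<Rightarrow> complex mat \<Rightarrow> bool" where
  "unitary_mat n U \<longleftrightarrow> U \<in> carrier_mat n n \<and>
     U * mat_adjoint U = 1\<^sub>m n \<and> mat_adjoint U * U = 1\<^sub>m n"

definition full_rate ::
    "complex set \<Rightarrow> nat \<Rightarrow> (complex \<Rightarrow> complex) \<Rightarrow> complex \<Rightarrow> (nat \<Rightarrow> complex) \<Rightarrow> real \<Rightarrow> bool" where
  "full_rate F n \<sigma> \<gamma> \<nu> c \<longleftrightarrow> inj_on (codeword n \<sigma> \<gamma> \<nu> c) (info_symbols F n)"

definition nonvanishing_det ::
    "complex set \<Rightarrow> nat \<Rightarrow> (complex \<Rightarrow> complex) \<Rightarrow> complex \<Rightarrow> (nat \<Rightarrow> complex) \<Rightarrow> real \<Rightarrow> bool" where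
  "nonvanishing_det F n \<sigma> \<gamma> \<nu> c \<longleftrightarrow>
     (\<exists>\<delta>>0. \<forall>M \<in> infinite_code F n \<sigma> \<gamma> \<nu> c. M \<noteq> 0\<^sub>m n n \<longrightarrow> (cmod (det M))\<^sup>2 \<ge> \<delta>)"

definition perfect_code ::
    "complex set \<Rightarrow> nat \<Rightarrow> (complex \<Rightarrow> complex) \<Rightarrow> complex \<Rightarrow> (nat \<Rightarrow> complex) \<Rightarrow> real \<Rightarrow> bool" where
  "perfect_code F n \<sigma> \<gamma> \<nu> c \<longleftrightarrow>
     full_rate F n \<sigma> \<gamma> \<nu> c \<and>
     nonvanishing_det F n \<sigma> \<gamma> \<nu> c \<and>
     unitary_mat n (layer_matrix n \<sigma> \<nu> c) \<and>
     cmod \<gamma> = 1"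

end

theory Submission
  imports Defs "HOL-Number_Theory.Number_Theory"
begin

text \<open>
  Write \<open>p = a\<^sup>2 + b\<^sup>2\<close> with \<open>a\<close> odd and \<open>b\<close> even, put \<open>\<pi> = a + b\<i>\<close>, so that \<open>\<pi> \<equiv> 1\<close> modulo \<open>2\<close>,
  and take \<open>\<nu>\<^sub>1 = (\<pi> + \<surd>p) / 2\<close> and \<open>\<nu>\<^sub>2 = (\<pi> - \<surd>p) / 2 = \<sigma>(\<nu>\<^sub>1)\<close>. They form a basis of the prime ideal of
  \<open>K\<close> above \<open>\<pi>\<close>, and the layer matrix is symmetric with rows \<open>(\<nu>\<^sub>1, \<nu>\<^sub>2) / \<surd>p\<close> and
  \<open>(\<nu>\<^sub>2, \<nu>\<^sub>1) / \<surd>p\<close>, which is unitary because \<open>\<bar>\<pi>\<bar>\<^sup>2 = p\<close>.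

  The determinant of a codeword is \<open>(N(x\<^sub>0) - \<i> N(x\<^sub>1)) / p\<close>, with numerator in \<open>\<int>[\<i>]\<close>. If it vanishes,
  clearing denominators gives Gaussian integers with \<open>a\<^sup>2 - p b\<^sup>2 = \<i> (c\<^sup>2 - p d\<^sup>2)\<close>. Since \<open>\<i>\<close> has order 4
  modulo a prime above \<open>p\<close> and \<open>8\<close> does not divide \<open>p - 1\<close>, it is not a square there, and infinite
  descent shows that all four numbers are zero.
\<close>

section \<open>Sums and products of algebraic integers\<close>

text \<open>A finitely generated additive group, the shape in which integrality is tested below: a
  number is integral once it maps such a nonzero group into itself.\<close>

definition int_span :: "('i \<Rightarrow> 'a :: field_char_0) \<Rightarrow> 'i set \<Rightarrow> 'a set" where
  "int_span v S = {\<Sum>s\<in>S. of_int (c s) * v s | c. True}"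

lemma int_spanI: "x = (\<Sum>s\<in>S. of_int (c s) * v s) \<Longrightarrow> x \<in> int_span v S"
  by (auto simp: int_span_def)

lemma int_span_add: "x \<in> int_span v S \<Longrightarrow> y \<in> int_span v S \<Longrightarrow> x + y \<in> int_span v S"
  unfolding int_span_def
  by clarsimp (rule exI[of _ "\<lambda>s. _ s + _ s"], simp add: sum.distrib distrib_right)

lemma int_span_scale: "x \<in> int_span v S \<Longrightarrow> of_int k * x \<in> int_span v S"
  unfolding int_span_def
  by clarsimp (rule exI[of _ "\<lambda>s. k * _ s"], simp add: sum_distrib_left mult.assoc)

lemma int_span_zero: "0 \<in> int_span v S"
  by (rule int_spanI[where c = "\<lambda>_. 0"]) simp

lemma int_span_sum: "(\<And>s. s \<in> A \<Longrightarrow> f s \<in> int_span v S) \<Longrightarrow> sum f A \<in> int_span v S"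
  by (induction A rule: infinite_finite_induct) (auto intro: int_span_zero int_span_add)

lemma int_span_base:
  assumes "finite S" "s \<in> S"
  shows "v s \<in> int_span v S"
  using assms by (intro int_spanI[where c = "\<lambda>t. if t = s then 1 else 0"])
    (simp add: if_distrib[of of_int] if_distrib[of "\<lambda>x. x * _"] sum.delta cong: if_cong)

lemma int_span_mult_closed:
  assumes "\<And>s. s \<in> S \<Longrightarrow> z * v s \<in> int_span v S" "x \<in> int_span v S"
  shows "z * x \<in> int_span v S"
proof -
  obtain c where x: "x = (\<Sum>s\<in>S. of_int (c s) * v s)"
    using assms(2) by (auto simp: int_span_def)
  have "z * x = (\<Sum>s\<in>S. of_int (c s) * (z * v s))"
    by (simp add: x sum_distrib_left mult_ac)
  thus ?thesis
    by (auto intro!: int_span_sum int_span_scale assms(1))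
qed

text \<open>The determinant trick. Multiplication by \<open>z\<close> acts on the generators by an
  integer matrix, the vector of generators is an eigenvector for \<open>z\<close>, and the
  characteristic polynomial is monic with integer coefficients. The generator \<open>v s0\<close>
  keeps that vector from being zero.\<close>

lemma algebraic_int_if_stabilizes_int_span:
  fixes z :: "'a :: field_char_0"
  assumes fin: "finite S" and ne: "s0 \<in> S" "v s0 \<noteq> 0"
    and st: "\<And>s. s \<in> S \<Longrightarrow> z * v s \<in> int_span v S"
  shows "algebraic_int z"
proof -
  define n where "n = card S"
  obtain g where g: "bij_betw g {..<n} S"
    using ex_bij_betw_nat_finite[OF fin] by (auto simp: n_def atLeast0LessThan)
  have gS: "g k \<in> S" if "k < n" for k
    using g that by (auto simp: bij_betw_def)
  have "\<forall>s\<in>S. \<exists>c. z * v s = (\<Sum>t\<in>S. of_int (c t) * v t)"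
    using st by (auto simp: int_span_def)
  then obtain c where c: "\<And>s. s \<in> S \<Longrightarrow> z * v s = (\<Sum>t\<in>S. of_int (c s t) * v t)"
    by metis
  define A :: "int mat" where "A = mat n n (\<lambda>(i, j). c (g i) (g j))"
  define B :: "'a mat" where "B = map_mat of_int A"
  have A: "A \<in> carrier_mat n n" and B: "B \<in> carrier_mat n n"
    by (auto simp: A_def B_def)
  define w where "w = vec n (\<lambda>k. v (g k))"
  have "B *\<^sub>v w = z \<cdot>\<^sub>v w"
  proof (rule eq_vecI)
    fix i assume "i < dim_vec (z \<cdot>\<^sub>v w)"
    hence i: "i < n" by (simp add: w_def)
    have "(B *\<^sub>v w) $ i = (\<Sum>j<n. of_int (c (g i) (g j)) * v (g j))"
      using i by (simp add: B_def A_def w_def scalar_prod_def atLeast0LessThan)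
    also have "\<dots> = (\<Sum>t\<in>S. of_int (c (g i) t) * v t)"
      by (rule sum.reindex_bij_betw[OF g])
    also have "\<dots> = z * v (g i)"
      using c[OF gS[OF i]] by simp
    finally show "(B *\<^sub>v w) $ i = (z \<cdot>\<^sub>v w) $ i"
      using i by (simp add: w_def)
  qed (simp add: w_def B_def A_def)
  moreover have "w \<noteq> 0\<^sub>v n"
  proof
    assume w0: "w = 0\<^sub>v n"
    obtain k where "k < n" "g k = s0"
      using g ne by (auto simp: bij_betw_def image_iff)
    hence "w $ k = v s0" "w $ k = 0" by (simp add: w_def, simp add: w0)
    with ne show False by simp
  qed
  moreover have "w \<in> carrier_vec n" "dim_row B = n"
    using B by (simp_all add: w_def)
  ultimately have "eigenvalue B z"
    unfolding eigenvalue_def eigenvector_def by metis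
  hence "poly (char_poly B) z = 0"
    using eigenvalue_root_char_poly[OF B] by simp
  moreover have "char_poly B = map_poly of_int (char_poly A)"
    unfolding B_def by (rule of_int_hom.char_poly_hom[OF A])
  moreover have "lead_coeff (char_poly A) = 1"
    using degree_monic_char_poly[OF A] by simp
  ultimately show ?thesis
    unfolding algebraic_int_altdef_ipoly by auto
qed

text \<open>The monic equation of \<open>x\<close> rewrites \<open>x ^ m\<close> through lower
  powers. The condition \<open>m > 0\<close> later supplies the nonzero generator
  \<open>x ^ 0\<close>.\<close>

lemma algebraic_int_power_reduce:
  fixes x :: "'a :: field_char_0"
  assumes "algebraic_int x"
  obtains m where "m > 0" "\<And>i. i < m \<Longrightarrow> x * x ^ i \<in> int_span (\<lambda>i. x ^ i) {..<m}"
proof -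
  obtain q :: "int poly" where q: "poly (map_poly of_int q) x = 0" "lead_coeff q = 1"
    using assms unfolding algebraic_int_altdef_ipoly by auto
  define m where "m = degree q"
  have "m > 0"
  proof (rule ccontr)
    assume "\<not> m > 0"
    hence "q = 1" using q(2) by (metis degree_eq_zeroE gr0I lead_coeff_pCons(2) m_def one_pCons)
    with q(1) show False by simp
  qed
  have "0 = (\<Sum>i\<le>m. of_int (coeff q i) * x ^ i)"
    using q(1) by (simp add: poly_altdef m_def)
  also have "\<dots> = (\<Sum>i<m. of_int (coeff q i) * x ^ i) + x ^ m"
    using q(2) by (simp add: lessThan_Suc_atMost[symmetric] m_def)
  finally have "x ^ m = (\<Sum>i<m. of_int (- coeff q i) * x ^ i)"
    by (simp add: sum_negf eq_neg_iff_add_eq_0 add.commute)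
  hence top: "x ^ m \<in> int_span (\<lambda>i. x ^ i) {..<m}"
    by (rule int_spanI)
  show ?thesis
  proof (rule that[OF \<open>m > 0\<close>])
    fix i assume "i < m"
    show "x * x ^ i \<in> int_span (\<lambda>i. x ^ i) {..<m}"
    proof (cases "Suc i = m")
      case True
      thus ?thesis using top by (metis power_Suc)
    next
      case False
      hence "Suc i \<in> {..<m}" using \<open>i < m\<close> by auto
      from int_span_base[OF _ this, of "\<lambda>i. x ^ i"] show ?thesis by simp
    qed
  qed
qed

lemma int_span_mult_right:
  assumes "a \<in> int_span f A" "finite A" "finite B" "j \<in> B"
  shows "a * g j \<in> int_span (\<lambda>(i, j). f i * g j) (A \<times> B)"
proof -
  obtain c where a: "a = (\<Sum>i\<in>A. of_int (c i) * f i)"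
    using assms(1) by (auto simp: int_span_def)
  have "a * g j = (\<Sum>i\<in>A. of_int (c i) * (f i * g j))"
    by (simp add: a sum_distrib_right mult.assoc)
  moreover have "f i * g j \<in> int_span (\<lambda>(i, j). f i * g j) (A \<times> B)" if "i \<in> A" for i
    using int_span_base[of "A \<times> B" "(i, j)" "\<lambda>(i, j). f i * g j"] that assms by simp
  ultimately show ?thesis
    by (auto intro!: int_span_sum int_span_scale)
qed

text \<open>Lets stability under \<open>y\<close> be read off from
  \<open>int_span_mult_right\<close>, which treats only the first factor.\<close>

lemma int_span_swap_subset:
  fixes f :: "'i \<Rightarrow> 'a :: field_char_0" and g :: "'j \<Rightarrow> 'a"
  shows "int_span (\<lambda>(i, j). f i * g j) (A \<times> B) \<subseteq> int_span (\<lambda>(j, i). g j * f i) (B \<times> A)"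
proof
  fix x assume "x \<in> int_span (\<lambda>(i, j). f i * g j) (A \<times> B)"
  then obtain c where "x = (\<Sum>s\<in>A \<times> B. of_int (c s) * (case s of (i, j) \<Rightarrow> f i * g j))"
    by (auto simp: int_span_def)
  also have "\<dots> = (\<Sum>s\<in>B \<times> A. of_int (c (prod.swap s)) * (case s of (j, i) \<Rightarrow> g j * f i))"
    by (rule sum.reindex_bij_witness[of _ prod.swap prod.swap]) (auto simp: mult_ac)
  finally show "x \<in> int_span (\<lambda>(j, i). g j * f i) (B \<times> A)"
    by (rule int_spanI)
qed

text \<open>The products \<open>x ^ i * y ^ j\<close> with \<open>i < m\<close> and
  \<open>j < n\<close> span a lattice that both numbers map into itself; the index
  \<open>(0, 0)\<close> gives the nonzero generator 1.\<close>

lemma algebraic_int_common_lattice: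
  fixes x y :: "'a :: field_char_0"
  assumes "algebraic_int x" "algebraic_int y"
  obtains S s0 and v :: "nat \<times> nat \<Rightarrow> 'a" where "finite S" "s0 \<in> S" "v s0 \<noteq> 0"
    "\<forall>s\<in>S. x * v s \<in> int_span v S \<and> y * v s \<in> int_span v S"
proof -
  obtain m where m: "m > 0" "\<And>i. i < m \<Longrightarrow> x * x ^ i \<in> int_span (\<lambda>i. x ^ i) {..<m}"
    using algebraic_int_power_reduce[OF assms(1)] by blast
  obtain n where n: "n > 0" "\<And>i. i < n \<Longrightarrow> y * y ^ i \<in> int_span (\<lambda>i. y ^ i) {..<n}"
    using algebraic_int_power_reduce[OF assms(2)] by blast
  let ?v = "\<lambda>(i, j). x ^ i * y ^ j" and ?S = "{..<m} \<times> {..<n}"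
  show ?thesis
  proof (rule that[of ?S "(0, 0)" ?v])
    have "x * ?v s \<in> int_span ?v ?S" and "y * ?v s \<in> int_span ?v ?S"
      if s_in: "s \<in> {..<m} \<times> {..<n}" for s
    proof -
      obtain i j where s: "s = (i, j)" "i < m" "j < n" using s_in by auto
      show "x * ?v s \<in> int_span ?v ?S"
        using int_span_mult_right[OF m(2)[OF s(2)], of "{..<n}" j "\<lambda>j. y ^ j"] s
        by (simp add: mult.assoc)
      show "y * ?v s \<in> int_span ?v ?S"
        using int_span_mult_right[OF n(2)[OF s(3)], of "{..<m}" i "\<lambda>i. x ^ i"] s
          int_span_swap_subset[of "\<lambda>j. y ^ j" "\<lambda>i. x ^ i" "{..<n}" "{..<m}"]
        by (auto simp: mult_ac)
    qed
    thus "\<forall>s\<in>?S. x * ?v s \<in> int_span ?v ?S \<and> y * ?v s \<in> int_span ?v ?S" by blast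
  qed (use m n in auto)
qed

text \<open>A lattice preserved by both numbers is preserved by their sum and their product.\<close>

lemma
  fixes x y :: "'a :: field_char_0"
  assumes "algebraic_int x" "algebraic_int y"
  shows algebraic_int_add: "algebraic_int (x + y)"
    and algebraic_int_mult: "algebraic_int (x * y)"
proof -
  obtain S s0 and v :: "nat \<times> nat \<Rightarrow> 'a" where v: "finite S" "s0 \<in> S" "v s0 \<noteq> 0"
    and xy: "\<forall>s\<in>S. x * v s \<in> int_span v S \<and> y * v s \<in> int_span v S"
    by (rule algebraic_int_common_lattice[OF assms])
  show "algebraic_int (x + y)"
  proof (rule algebraic_int_if_stabilizes_int_span[of S s0 v, OF v])
    show "(x + y) * v s \<in> int_span v S" if "s \<in> S" for s
      using int_span_add[of "x * v s" v S "y * v s"] xy that by (simp add: distrib_right)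
  qed
  show "algebraic_int (x * y)"
  proof (rule algebraic_int_if_stabilizes_int_span[of S s0 v, OF v])
    show "(x * y) * v s \<in> int_span v S" if "s \<in> S" for s
      using int_span_mult_closed[of S x v "y * v s"] xy that by (simp add: mult.assoc)
  qed
qed

lemma algebraic_int_diff:
  fixes x y :: "'a :: field_char_0"
  assumes "algebraic_int x" "algebraic_int y"
  shows "algebraic_int (x - y)"
  using algebraic_int_add[of x "- y"] assms by auto

section \<open>Residues and sums of two squares modulo a prime\<close>

text \<open>Euler's criterion for -1: the exponent (p - 1)/2 is even.\<close>

lemma minus_one_square_mod:
  fixes p :: nat
  assumes "prime p" "p mod 4 = 1"
  obtains r :: int where "int p dvd r\<^sup>2 + 1"
proof -
  have "p \<noteq> 2" "p > 1"
    using assms(2) prime_gt_1_nat[OF assms(1)] by auto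
  hence "p > 2" by simp
  have "even ((p - 1) div 2)"
    using assms(2) by presburger
  hence "[Legendre (-1) (int p) = 1] (mod (int p))"
    using euler_criterion[OF assms(1) \<open>p > 2\<close>, of "-1"] by simp
  moreover have "\<not> [- 1 = 1] (mod int p)" "\<not> [0 = 1] (mod int p)"
    using \<open>p > 2\<close> by (auto simp: cong_iff_dvd_diff zdvd_not_zless)
  ultimately have "QuadRes (int p) (-1)"
    by (auto simp: Legendre_def split: if_splits)
  then obtain r where "[r\<^sup>2 = - 1] (mod int p)"
    by (auto simp: QuadRes_def)
  thus ?thesis using that by (auto simp: cong_iff_dvd_diff)
qed

text \<open>Thue's pigeonhole argument: a collision of x - r y modulo \<open>p\<close> on a small
  box gives a nonzero pair with a = r b modulo \<open>p\<close>. Then a^2 + b^2 is a multiple of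
  \<open>p\<close> strictly between 0 and 2p.\<close>

lemma two_squares_of_minus_one_square:
  fixes p :: nat and r :: int
  assumes p: "prime p" and r: "int p dvd r\<^sup>2 + 1"
  obtains a b :: int where "int p = a\<^sup>2 + b\<^sup>2"
proof -
  \<comment> \<open>With k^2 < p < (k + 1)^2 the box has more than \<open>p\<close> points, while
    coordinate differences have squares below \<open>p\<close>.\<close>
  define k where "k = nat \<lfloor>sqrt p\<rfloor>"
  have k1: "real k \<le> sqrt p" and k2: "sqrt p < real k + 1"
    by (auto simp: k_def)
  have "(real k)\<^sup>2 \<le> (sqrt p)\<^sup>2"
    using k1 by (intro power_mono) auto
  hence "real (k\<^sup>2) \<le> real p" by simp
  hence kle: "k\<^sup>2 \<le> p" by (simp only: of_nat_le_iff)
  have kne: "k\<^sup>2 \<noteq> p"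
    using p by (auto simp: prime_power_iff)
  have "(sqrt p)\<^sup>2 < (real k + 1)\<^sup>2"
    using k2 by (intro power_strict_mono) auto
  hence "real p < real ((k + 1)\<^sup>2)" by (simp add: add.commute)
  hence kgt: "p < (k + 1)\<^sup>2" by (simp only: of_nat_less_iff)
  let ?S = "{0..int k} \<times> {0..int k}"
  let ?f = "\<lambda>(x, y). (x - r * y) mod int p"
  have "?f ` ?S \<subseteq> {0..<int p}"
    using prime_gt_0_nat[OF p] by auto
  hence "card (?f ` ?S) \<le> p"
    using card_mono[of "{0..<int p}" "?f ` ?S"] by simp
  also have "\<dots> < card ?S"
    using kgt by (simp add: power2_eq_square nat_add_distrib)
  finally have "\<not> inj_on ?f ?S"
    by (metis card_image less_irrefl)
  then obtain x y x' y' where xy: "(x, y) \<in> ?S" "(x', y') \<in> ?S" "(x, y) \<noteq> (x', y')"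
    and eq: "(x - r * y) mod int p = (x' - r * y') mod int p"
    unfolding inj_on_def by auto
  define a b where "a = x - x'" and "b = y - y'"
  have "int p dvd (x - r * y) - (x' - r * y')"
    using eq by (simp add: mod_eq_dvd_iff)
  hence d: "int p dvd a - r * b"
    by (simp add: a_def b_def algebra_simps)
  have "int p dvd (a - r * b) * (a + r * b) + b\<^sup>2 * (r\<^sup>2 + 1)"
    by (rule dvd_add[OF dvd_mult2[OF d] dvd_mult[OF r]])
  also have "(a - r * b) * (a + r * b) + b\<^sup>2 * (r\<^sup>2 + 1) = a\<^sup>2 + b\<^sup>2"
    by (simp add: algebra_simps power2_eq_square)
  finally have pd: "int p dvd a\<^sup>2 + b\<^sup>2" .
  have "\<bar>a\<bar> \<le> int k" "\<bar>b\<bar> \<le> int k"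
    using xy by (auto simp: a_def b_def)
  hence "a\<^sup>2 \<le> (int k)\<^sup>2" "b\<^sup>2 \<le> (int k)\<^sup>2"
    by (metis abs_of_nat abs_le_square_iff)+
  moreover have "(int k)\<^sup>2 < int p"
    using kle kne by (metis le_neq_implies_less of_nat_less_iff of_nat_power)
  ultimately have lt: "a\<^sup>2 + b\<^sup>2 < 2 * int p" by linarith
  have pos: "a\<^sup>2 + b\<^sup>2 > 0"
    using xy(3) by (auto simp: a_def b_def sum_power2_gt_zero_iff)
  obtain m where m: "a\<^sup>2 + b\<^sup>2 = int p * m" using pd by (elim dvdE)
  have "m > 0" using pos m by (metis of_nat_0_le_iff zero_less_mult_pos prime_gt_0_nat[OF p] of_nat_0_less_iff)
  moreover have "m < 2" using lt m prime_gt_0_nat[OF p] by (simp add: mult.commute)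
  ultimately have "m = 1" by linarith
  with m have "int p = a\<^sup>2 + b\<^sup>2" by simp
  thus ?thesis by (rule that)
qed

text \<open>The odd square is written with \<open>2 * c - 1\<close> so that, for \<pi> = (2c - 1) +
  2d i, the number (1 + \<pi>)/2 is simply c + d i.\<close>

lemma prime_1_mod_4_odd_even_two_squares:
  fixes p :: nat
  assumes p: "prime p" "p mod 4 = 1"
  obtains c d :: int where "int p = (2 * c - 1)\<^sup>2 + (2 * d)\<^sup>2"
proof -
  obtain r :: int where "int p dvd r\<^sup>2 + 1" using p by (rule minus_one_square_mod)
  with p(1) obtain a b :: int where ab: "int p = a\<^sup>2 + b\<^sup>2"
    by (rule two_squares_of_minus_one_square)
  have "odd (int p)" using p(2) by presburger
  hence parity: "odd a \<longleftrightarrow> even b" unfolding ab by simp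
  note thesis_intro = that
  have thesis_if: thesis if ab: "int p = a\<^sup>2 + b\<^sup>2" and odd: "odd a" and even: "even b" for a b :: int
  proof -
    obtain d where d: "b = 2 * d" using even by (elim evenE)
    obtain c where "a = 2 * c + 1" using odd by (elim oddE)
    hence "a = 2 * (c + 1) - 1" by simp
    with d ab show thesis using thesis_intro by blast
  qed
  show thesis
  proof (cases "odd a")
    case True
    thus ?thesis using thesis_if[OF ab] parity by simp
  next
    case False
    thus ?thesis using thesis_if[of b a] ab parity by (simp add: add.commute)
  qed
qed

text \<open>Here (p - 1)/4 is odd. If \<open>p\<close> divided neither number, raising a^4 = -c^4 to
  this power would give 1 = -1 modulo \<open>p\<close> by Fermat.\<close>

lemma prime_5_mod_8_dvd_sum_fourth_powers:
  fixes p :: nat and a c :: int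
  assumes p: "prime p" "p mod 8 = 5" and d: "int p dvd a ^ 4 + c ^ 4"
  shows "int p dvd a \<and> int p dvd c"
proof (rule ccontr)
  assume *: "\<not> ?thesis"
  have pr: "prime (int p)" using p by simp
  have "int p dvd a \<longleftrightarrow> int p dvd c"
  proof -
    have "int p dvd a ^ 4 \<longleftrightarrow> int p dvd c ^ 4"
      using d by (metis dvd_add_right_iff dvd_add_left_iff)
    thus ?thesis using pr by (simp add: prime_dvd_power_iff)
  qed
  with * have na: "\<not> int p dvd a" and nc: "\<not> int p dvd c" by auto
  define k where "k = p div 8"
  have pk: "p - 1 = 4 * (2 * k + 1)" using p(2) unfolding k_def by presburger
  have fermat: "[x ^ (p - 1) = 1] (mod int p)" if "\<not> int p dvd x" for x :: int
  proof -
    have "\<not> p dvd nat \<bar>x\<bar>" using that by (simp add: dvd_nat_abs_iff)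
    hence "[int (nat \<bar>x\<bar> ^ (p - 1)) = int 1] (mod int p)"
      using fermat_theorem[OF p(1)] by (simp only: cong_int_iff)
    thus ?thesis unfolding pk power_mult by simp
  qed
  have "[a ^ 4 = - (c ^ 4)] (mod int p)"
    using d by (simp add: cong_iff_dvd_diff)
  hence "[(a ^ 4) ^ (2 * k + 1) = (- (c ^ 4)) ^ (2 * k + 1)] (mod int p)"
    by (rule cong_pow)
  hence "[a ^ (p - 1) = - (c ^ (p - 1))] (mod int p)"
    unfolding pk power_mult by simp
  moreover have "[- (c ^ (p - 1)) = - 1] (mod int p)"
    using fermat[OF nc] by (simp add: cong_minus_minus_iff)
  ultimately have "[1 = - 1] (mod int p)"
    using fermat[OF na] by (metis cong_sym cong_trans)
  hence "int p dvd 2" by (simp add: cong_iff_dvd_diff)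
  hence "int p \<le> 2" by (rule zdvd_imp_le) simp
  thus False using p(2) by (cases "p = 0"; cases "p = 1"; cases "p = 2") auto
qed

section \<open>Gaussian integers\<close>

definition gauss_ints :: "complex set" where
  "gauss_ints = {z. Re z \<in> \<int> \<and> Im z \<in> \<int>}"

lemma gauss_intsE:
  assumes "z \<in> gauss_ints"
  obtains a b where "z = of_int a + of_int b * \<i>"
  using assms that by (auto simp: gauss_ints_def complex_eq_iff elim!: Ints_cases)

lemma gauss_ints_closed [simp]:
  "0 \<in> gauss_ints" "1 \<in> gauss_ints" "\<i> \<in> gauss_ints" "of_int n \<in> gauss_ints"
  "of_nat m \<in> gauss_ints" "numeral k \<in> gauss_ints"
  "x \<in> gauss_ints \<Longrightarrow> y \<in> gauss_ints \<Longrightarrow> x + y \<in> gauss_ints"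
  "x \<in> gauss_ints \<Longrightarrow> y \<in> gauss_ints \<Longrightarrow> x - y \<in> gauss_ints"
  "x \<in> gauss_ints \<Longrightarrow> y \<in> gauss_ints \<Longrightarrow> x * y \<in> gauss_ints"
  "x \<in> gauss_ints \<Longrightarrow> - x \<in> gauss_ints"
  "x \<in> gauss_ints \<Longrightarrow> x ^ j \<in> gauss_ints"
proof -
  show mult: "x * y \<in> gauss_ints" if "x \<in> gauss_ints" "y \<in> gauss_ints" for x y
    using that by (auto simp: gauss_ints_def)
  show "x ^ j \<in> gauss_ints" if "x \<in> gauss_ints" for x
    using that by (induction j) (auto simp: mult, simp add: gauss_ints_def)
qed (auto simp: gauss_ints_def)

lemma gauss_ints_divide_of_int:
  assumes "k dvd a" "k dvd b"
  shows "(of_int a + of_int b * \<i>) / of_int k \<in> gauss_ints"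
\<comment> \<open>For \<open>k = 0\<close> the quotient is 0 by convention, which the closing
  \<open>simp\<close> handles.\<close>
proof (cases "k = 0")
  case False
  obtain a' b' where "a = k * a'" "b = k * b'" using assms by (elim dvdE)
  hence "(of_int a + of_int b * \<i>) / of_int k = of_int a' + of_int b' * \<i>"
    using False by (simp add: field_simps)
  thus ?thesis by simp
qed simp

text \<open>The squared modulus is a positive integer. This discreteness ends the infinite descent
  and later bounds the determinants away from zero.\<close>

lemma cmod_gauss_int_ge_1:
  assumes "z \<in> gauss_ints" "z \<noteq> 0"
  shows "cmod z \<ge> 1"
proof -
  obtain a b where z: "z = of_int a + of_int b * \<i>" using assms(1) by (rule gauss_intsE)
  have "a\<^sup>2 + b\<^sup>2 \<ge> 1"
    using assms(2) z by (metis add.commute add_0 int_one_le_iff_zero_less mult_zero_left of_int_0 sum_power2_gt_zero_iff)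
  hence "1 \<le> real_of_int (a\<^sup>2 + b\<^sup>2)" by linarith
  also have "\<dots> = (cmod z)\<^sup>2" by (simp add: z cmod_power2)
  finally have "1\<^sup>2 \<le> (cmod z)\<^sup>2" by simp
  thus ?thesis by (rule power2_le_imp_le) simp
qed

text \<open>Divisibility by \<open>p\<close> in \<open>\<int>[\<i>]\<close> is tested by the two reductions \<open>\<i> \<mapsto> r\<close> and \<open>\<i> \<mapsto> - r\<close>
  modulo \<open>p\<close>, where \<open>r\<^sup>2 \<equiv> - 1\<close>.\<close>

lemma gauss_int_dvd_if_square_diff:
  fixes p :: nat
  assumes p: "prime p" "p mod 8 = 5"
    and zw: "z \<in> gauss_ints" "w \<in> gauss_ints"
    and d: "(z\<^sup>2 - \<i> * w\<^sup>2) / of_nat p \<in> gauss_ints"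
  shows "z / of_nat p \<in> gauss_ints \<and> w / of_nat p \<in> gauss_ints"
proof -
  have "p mod 4 = 1" using p(2) by presburger
  with p(1) obtain r where r: "int p dvd r\<^sup>2 + 1" by (rule minus_one_square_mod)
  obtain z1 z2 where z: "z = of_int z1 + of_int z2 * \<i>" using zw(1) by (rule gauss_intsE)
  obtain w1 w2 where w: "w = of_int w1 + of_int w2 * \<i>" using zw(2) by (rule gauss_intsE)
  have p0: "p > 0" using p prime_gt_0_nat by blast
  obtain q1 q2 where "(z\<^sup>2 - \<i> * w\<^sup>2) / of_nat p = of_int q1 + of_int q2 * \<i>"
    using d by (rule gauss_intsE)
  hence "z\<^sup>2 - \<i> * w\<^sup>2 = of_nat p * (of_int q1 + of_int q2 * \<i>)"
    using p0 by (simp add: field_simps)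
  hence "of_int (z1\<^sup>2 - z2\<^sup>2 + 2 * w1 * w2) = (of_int (int p * q1) :: real)"
    "of_int (2 * z1 * z2 - w1\<^sup>2 + w2\<^sup>2) = (of_int (int p * q2) :: real)"
    by (auto simp: z w complex_eq_iff power2_eq_square algebra_simps)
  hence e1: "z1\<^sup>2 - z2\<^sup>2 + 2 * w1 * w2 = int p * q1" and
    e2: "2 * z1 * z2 - w1\<^sup>2 + w2\<^sup>2 = int p * q2"
    by (simp_all only: of_int_eq_iff)
  have *: "int p dvd z1 + t * z2 \<and> int p dvd w1 + t * w2" if t: "int p dvd t\<^sup>2 + 1" for t
  proof (rule prime_5_mod_8_dvd_sum_fourth_powers[OF p])
    let ?A = "z1 + t * z2" and ?C = "w1 + t * w2"
    \<comment> \<open>The image of z^2 - i w^2 under i -> t; the last summand is the error made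
      because t^2 is -1 only modulo \<open>p\<close>.\<close>
    have "?A\<^sup>2 - t * ?C\<^sup>2 = (z1\<^sup>2 - z2\<^sup>2 + 2 * w1 * w2) + t * (2 * z1 * z2 - w1\<^sup>2 + w2\<^sup>2)
            + (t\<^sup>2 + 1) * (z2\<^sup>2 - 2 * w1 * w2 - t * w2\<^sup>2)"
      by (simp add: algebra_simps power2_eq_square)
    also have "int p dvd \<dots>"
      unfolding e1 e2 by (rule dvd_add[OF dvd_add dvd_mult2[OF t]]) simp_all
    \<comment> \<open>Modulo \<open>p\<close>, A^2 = t C^2 and t^2 = -1, so A^4 = -C^4.\<close>
    finally have "int p dvd (?A\<^sup>2 - t * ?C\<^sup>2) * (?A\<^sup>2 + t * ?C\<^sup>2) + (t\<^sup>2 + 1) * ?C ^ 4"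
      by (rule dvd_add[OF dvd_mult2 dvd_mult2[OF t]])
    also have "(?A\<^sup>2 - t * ?C\<^sup>2) * (?A\<^sup>2 + t * ?C\<^sup>2) + (t\<^sup>2 + 1) * ?C ^ 4 = ?A ^ 4 + ?C ^ 4"
      by (simp add: algebra_simps power2_eq_square power4_eq_xxxx)
    finally show "int p dvd ?A ^ 4 + ?C ^ 4" .
  qed
  have pr: "prime (int p)" using p by simp
  have odd: "\<not> int p dvd 2"
    using p(2) zdvd_imp_le[of "int p" 2] by (cases "p = 0"; cases "p = 1"; cases "p = 2") auto
  have nr: "\<not> int p dvd r"
    using r pr by (metis dvd_add_right_iff dvd_mult2 not_prime_unit power2_eq_square)
  \<comment> \<open>The two reductions together detect divisibility: their sum and difference are 2x
    and 2ry, and both 2 and \<open>r\<close> are units modulo \<open>p\<close>.\<close>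
  have split: "int p dvd x \<and> int p dvd y" if "int p dvd x + r * y" "int p dvd x + (- r) * y" for x y
  proof -
    have "int p dvd (x + r * y) + (x + (- r) * y)" "int p dvd (x + r * y) - (x + (- r) * y)"
      using dvd_add[OF that] dvd_diff[OF that] by blast+
    hence "int p dvd 2 * x" "int p dvd 2 * (r * y)" by simp_all
    thus ?thesis using pr odd nr by (simp add: prime_dvd_mult_iff)
  qed
  have m: "int p dvd (- r)\<^sup>2 + 1" using r by simp
  have "int p dvd z1 \<and> int p dvd z2" "int p dvd w1 \<and> int p dvd w2"
    using split *[OF r] *[OF m] by blast+
  thus ?thesis
    using gauss_ints_divide_of_int[of "int p"] by (simp add: z w)
qed

text \<open>This is the reduced norm form of the quaternion algebra behind the code, so it says that
  \<open>\<i>\<close> is not a norm.\<close>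

lemma quaternion_norm_form_anisotropic:
  fixes p :: nat
  assumes p: "prime p" "p mod 8 = 5"
    and g: "a \<in> gauss_ints" "b \<in> gauss_ints" "c \<in> gauss_ints" "d \<in> gauss_ints"
    and eq: "a\<^sup>2 - of_nat p * b\<^sup>2 = \<i> * (c\<^sup>2 - of_nat p * d\<^sup>2)"
  shows "a = 0 \<and> b = 0 \<and> c = 0 \<and> d = 0"
proof -
  let ?P = "of_nat p :: complex"
  have p1: "p > 1" using p prime_gt_1_nat by blast
  hence p0: "?P \<noteq> 0" by simp
  \<comment> \<open>One descent step. The equation first makes a^2 - i c^2 divisible by
    \<open>p\<close>, hence \<open>a\<close> and \<open>c\<close>; dividing once more makes b^2 - i
    d^2 divisible, hence \<open>b\<close> and \<open>d\<close>.\<close>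
  have step: "a / ?P \<in> gauss_ints \<and> b / ?P \<in> gauss_ints \<and> c / ?P \<in> gauss_ints \<and> d / ?P \<in> gauss_ints"
    if g: "a \<in> gauss_ints" "b \<in> gauss_ints" "c \<in> gauss_ints" "d \<in> gauss_ints"
    and eq: "a\<^sup>2 - of_nat p * b\<^sup>2 = \<i> * (c\<^sup>2 - of_nat p * d\<^sup>2)" for a b c d
  proof -
    have "(a\<^sup>2 - \<i> * c\<^sup>2) / ?P = b\<^sup>2 - \<i> * d\<^sup>2"
      using eq p0 by (simp add: field_simps)
    hence "(a\<^sup>2 - \<i> * c\<^sup>2) / ?P \<in> gauss_ints" using g by auto
    with gauss_int_dvd_if_square_diff[OF p g(1,3)]
    have ac: "a / ?P \<in> gauss_ints" "c / ?P \<in> gauss_ints" by auto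
    have "(b\<^sup>2 - \<i> * d\<^sup>2) / ?P = (a / ?P)\<^sup>2 - \<i> * (c / ?P)\<^sup>2"
      using eq p0 by (simp add: field_simps power2_eq_square)
    also have "\<dots> \<in> gauss_ints" using ac by auto
    finally show ?thesis
      using gauss_int_dvd_if_square_diff[OF p g(2,4)] ac by auto
  qed
  \<comment> \<open>The equation is homogeneous, so the quotients satisfy it again and the step can
    be iterated.\<close>
  have all: "a / ?P ^ k \<in> gauss_ints \<and> b / ?P ^ k \<in> gauss_ints \<and> c / ?P ^ k \<in> gauss_ints \<and>
      d / ?P ^ k \<in> gauss_ints" for k
  proof (induction k)
    case (Suc k)
    have "(a / ?P ^ k)\<^sup>2 - ?P * (b / ?P ^ k)\<^sup>2 = (a\<^sup>2 - ?P * b\<^sup>2) / (?P ^ k)\<^sup>2"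
      by (simp add: power_divide diff_divide_distrib)
    also have "\<dots> = \<i> * ((c / ?P ^ k)\<^sup>2 - ?P * (d / ?P ^ k)\<^sup>2)"
      unfolding eq by (simp add: power_divide flip: diff_divide_distrib)
    finally show ?case
      using step[of "a / ?P ^ k" "b / ?P ^ k" "c / ?P ^ k" "d / ?P ^ k"] Suc
      by (simp add: mult.commute)
  qed (use g in auto)
  \<comment> \<open>Enough divisions by \<open>p\<close> push the modulus of a nonzero number below
    1.\<close>
  have zero: "x = 0" if "\<And>k. x / ?P ^ k \<in> gauss_ints" for x
  proof (rule ccontr)
    assume x: "x \<noteq> 0"
    obtain k where k: "cmod x < real p ^ k"
      using real_arch_pow[of "real p"] p1 by auto
    have "cmod (x / ?P ^ k) \<ge> 1"
      using that x p0 by (intro cmod_gauss_int_ge_1) auto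
    hence "cmod x \<ge> real p ^ k" using p1
      by (simp add: norm_divide norm_power field_simps)
    with k show False by simp
  qed
  show ?thesis using all zero by blast
qed

section \<open>Quadratic extensions\<close>

lemma complex_ring_simps [simp]:
  "carrier complex_ring = UNIV" "monoid.mult complex_ring = (*)" "monoid.one complex_ring = 1"
  "ring.zero complex_ring = 0" "ring.add complex_ring = (+)"
  by (auto simp: ring_of_type_algebra_def fun_eq_iff)

lemma field_complex_ring: "Ring.field complex_ring"
  by (rule field_from_type_algebra)

interpretation complex_ring: cring complex_ring
  by (rule cring_from_type_algebra)

lemma complex_ring_a_inv [simp]: "a_inv complex_ring x = - x"
  by (rule complex_ring.minus_equality) auto

lemma complex_ring_m_inv [simp]: "x \<noteq> 0 \<Longrightarrow> m_inv complex_ring x = inverse x"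
  by (rule complex_ring.comm_inv_char) auto

text \<open>Translates the abstract notion into closure conditions; closure under differences
  already yields zero, negatives and sums.\<close>

lemma subfield_complex_ring_iff:
  "subfield L complex_ring \<longleftrightarrow> 1 \<in> L \<and> (\<forall>x\<in>L. \<forall>y\<in>L. x - y \<in> L \<and> x * y \<in> L) \<and>
     (\<forall>x\<in>L. x \<noteq> 0 \<longrightarrow> inverse x \<in> L)"
  (is "_ \<longleftrightarrow> ?R")
proof
  assume L: "subfield L complex_ring"
  note sr = subfieldE(1)[OF L]
  show ?R
  proof (intro conjI ballI impI)
    show "1 \<in> L" using subringE(3)[OF sr] by simp
    fix x y assume xy: "x \<in> L" "y \<in> L"
    show "x * y \<in> L" using subringE(6)[OF sr xy] by simp
    show "x - y \<in> L" using subringE(7)[OF sr xy(1) subringE(5)[OF sr xy(2)]] by simp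
  next
    fix x assume "x \<in> L" "x \<noteq> 0"
    thus "inverse x \<in> L" using complex_ring.subfield_m_inv(1)[OF L, of x] by simp
  qed
next
  assume R: ?R
  have neg: "- x \<in> L" if "x \<in> L" for x
    using R that by (metis diff_0 diff_self)
  have add: "x + y \<in> L" if "x \<in> L" "y \<in> L" for x y
    using R neg[of y] that by (metis diff_minus_eq_add)
  show "subfield L complex_ring"
  proof (rule field.subfieldI'[OF field_complex_ring])
    show "subring L complex_ring"
      by (rule complex_ring.subringI) (use R neg add in auto)
    show "inv\<^bsub>complex_ring\<^esub> k \<in> L" if "k \<in> L - {\<zero>\<^bsub>complex_ring\<^esub>}" for k
      using R that by simp
  qed
qed

lemma Rats_subset_subfield:
  assumes "subfield L complex_ring"
  shows "\<rat> \<subseteq> L"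
proof
  fix x :: complex assume "x \<in> \<rat>"
  then obtain a b where x: "x = of_int a / of_int b" "b \<noteq> 0"
    by (auto elim!: Rats_cases')
  have one: "1 \<in> L" and diff: "\<And>x y. x \<in> L \<Longrightarrow> y \<in> L \<Longrightarrow> x - y \<in> L"
    and mult: "\<And>x y. x \<in> L \<Longrightarrow> y \<in> L \<Longrightarrow> x * y \<in> L"
    and inv: "\<And>x. x \<in> L \<Longrightarrow> x \<noteq> 0 \<Longrightarrow> inverse x \<in> L"
    using assms by (auto simp: subfield_complex_ring_iff)
  have zero: "0 \<in> L" using diff[OF one one] by simp
  have "of_int k \<in> L" for k
  proof (induction k rule: int_induct[where k = 0])
    case (step1 i)
    thus ?case using diff[of "of_int i" "0 - 1"] diff[of 0 1] zero one by simp
  next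
    case (step2 i)
    thus ?case using diff[of "of_int i" 1] one by simp
  qed (simp add: zero)
  thus "x \<in> L" using x mult inv by (auto simp: divide_inverse)
qed

text \<open>Instantiated twice to climb a tower: Q(i) over Q, then Q(i, sqrt p) over Q(i).\<close>

locale quadratic_extension =
  fixes L :: "complex set" and s :: complex
  assumes subfield_base: "subfield L complex_ring"
    and square_in_base: "s\<^sup>2 \<in> L"
    and not_in_base: "s \<notin> L"
begin

lemma one_in_base [simp]: "1 \<in> L"
  and diff_in_base [simp, intro]: "x \<in> L \<Longrightarrow> y \<in> L \<Longrightarrow> x - y \<in> L"
  and mult_in_base [simp, intro]: "x \<in> L \<Longrightarrow> y \<in> L \<Longrightarrow> x * y \<in> L"
  using subfield_base by (auto simp: subfield_complex_ring_iff)

lemma zero_in_base [simp]: "0 \<in> L"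
  using diff_in_base[of 1 1] by simp

lemma minus_in_base [simp, intro]: "x \<in> L \<Longrightarrow> - x \<in> L"
  using diff_in_base[of 0 x] by simp

lemma add_in_base [simp, intro]: "x \<in> L \<Longrightarrow> y \<in> L \<Longrightarrow> x + y \<in> L"
  using diff_in_base[of x "- y"] by simp

lemma inverse_in_base [simp, intro]: "x \<in> L \<Longrightarrow> inverse x \<in> L"
  using subfield_base by (cases "x = 0") (auto simp: subfield_complex_ring_iff)

lemma divide_in_base [simp, intro]: "x \<in> L \<Longrightarrow> y \<in> L \<Longrightarrow> x / y \<in> L"
  by (simp add: divide_inverse)

definition ext :: "complex set" where
  "ext = {u + v * s | u v. u \<in> L \<and> v \<in> L}"

lemma extI: "u \<in> L \<Longrightarrow> v \<in> L \<Longrightarrow> u + v * s \<in> ext"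
  by (auto simp: ext_def)

lemma extE:
  assumes "x \<in> ext"
  obtains u v where "u \<in> L" "v \<in> L" "x = u + v * s"
  using assms by (auto simp: ext_def)

text \<open>A nonzero \<open>v\<close> would put \<open>s = - u / v\<close> into
  \<open>L\<close>.\<close>

lemma coords_zero:
  assumes "u \<in> L" "v \<in> L" "u + v * s = 0"
  shows "u = 0 \<and> v = 0"
proof -
  have "v = 0"
  proof (rule ccontr)
    assume "v \<noteq> 0"
    hence "s = - u / v" using assms(3) by (simp add: field_simps eq_neg_iff_add_eq_0)
    thus False using assms not_in_base by auto
  qed
  thus ?thesis using assms by simp
qed

lemma coords_eq_iff:
  assumes "u \<in> L" "v \<in> L" "u' \<in> L" "v' \<in> L"
  shows "u + v * s = u' + v' * s \<longleftrightarrow> u = u' \<and> v = v'"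
  using coords_zero[of "u - u'" "v - v'"] assms by (auto simp: algebra_simps)

lemma square_of_s: "s * s \<in> L"
  using square_in_base by (simp add: power2_eq_square)

lemma base_subset_ext: "L \<subseteq> ext"
  using extI[of _ 0] by auto

lemma s_in_ext: "s \<in> ext"
  using extI[of 0 1] by simp

lemma ext_mult:
  assumes "x \<in> ext" "y \<in> ext"
  shows "x * y \<in> ext"
proof -
  obtain u v where x: "u \<in> L" "v \<in> L" "x = u + v * s" using assms(1) by (rule extE)
  obtain u' v' where y: "u' \<in> L" "v' \<in> L" "y = u' + v' * s" using assms(2) by (rule extE)
  have "x * y = (u * u' + v * v' * (s * s)) + (u * v' + v * u') * s"
    by (simp add: x y algebra_simps)
  also have "\<dots> \<in> ext" using x y square_of_s by (intro extI) auto
  finally show ?thesis .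
qed

lemma ext_diff:
  assumes "x \<in> ext" "y \<in> ext"
  shows "x - y \<in> ext"
proof -
  obtain u v where x: "u \<in> L" "v \<in> L" "x = u + v * s" using assms(1) by (rule extE)
  obtain u' v' where y: "u' \<in> L" "v' \<in> L" "y = u' + v' * s" using assms(2) by (rule extE)
  have "x - y = (u - u') + (v - v') * s"
    by (simp add: x y algebra_simps)
  also have "\<dots> \<in> ext" using x y by (intro extI) auto
  finally show ?thesis .
qed

lemma subfield_ext: "subfield ext complex_ring"
  unfolding subfield_complex_ring_iff
proof (intro conjI ballI impI)
  show "1 \<in> ext" using base_subset_ext by auto
  fix x assume x: "x \<in> ext" "x \<noteq> 0"
  obtain u v where uv: "u \<in> L" "v \<in> L" "x = u + v * s" using x(1) by (rule extE)
  \<comment> \<open>Rationalising the denominator: the product of \<open>x\<close> with this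
    conjugate lies in \<open>L\<close>, where inverses exist.\<close>
  let ?y = "u + (- v) * s"
  have y0: "?y \<noteq> 0"
    using coords_zero[of u "- v"] uv x(2) by auto
  have N: "x * ?y \<in> L"
  proof -
    have "x * ?y = u * u - (v * v) * (s * s)" by (simp add: uv algebra_simps)
    thus ?thesis using square_of_s uv by auto
  qed
  have "inverse x = inverse (x * ?y) * ?y"
    using x y0 by (simp add: field_simps)
  also have "\<dots> \<in> ext"
    using N uv base_subset_ext by (intro ext_mult extI) auto
  finally show "inverse x \<in> ext" .
qed (auto intro: ext_mult ext_diff)

lemma ext_add: "x \<in> ext \<Longrightarrow> y \<in> ext \<Longrightarrow> x + y \<in> ext"
  using ext_diff[of x "0 - y"] ext_diff[of 0 y] subsetD[OF base_subset_ext, of 0] by simp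

lemma ext_eq_generate_field:
  assumes "L = generate_field complex_ring S"
  shows "ext = generate_field complex_ring (insert s S)"
proof
  have "S \<subseteq> L" using assms by (auto intro: generate_field.incl)
  hence "insert s S \<subseteq> ext" using base_subset_ext s_in_ext by auto
  thus "generate_field complex_ring (insert s S) \<subseteq> ext"
    by (intro field.generate_field_min_subfield1[OF field_complex_ring] subfield_ext) auto
  have sf: "subfield (generate_field complex_ring (insert s S)) complex_ring"
    by (rule field.generate_field_is_subfield[OF field_complex_ring]) auto
  have "L \<subseteq> generate_field complex_ring (insert s S)"
    unfolding assms by (intro field.mono_generate_field[OF field_complex_ring]) auto
  moreover have "s \<in> generate_field complex_ring (insert s S)"
    by (auto intro: generate_field.incl)
  ultimately show "ext \<subseteq> generate_field complex_ring (insert s S)"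
    using subringE(6,7)[OF subfieldE(1)[OF sf]]
    by (auto simp: subset_iff elim!: extE)
qed

text \<open>Dimension grows by one with each line extension along a vector outside the space: first
  1 over the zero space, giving \<open>L\<close>, then \<open>s\<close> over
  \<open>L\<close>.\<close>

lemma dimension_ext: "complex_ring.dimension 2 L ext"
proof -
  have le: "complex_ring.line_extension L a E = {u * a + x | u x. u \<in> L \<and> x \<in> E}" for a E
    by (auto simp: complex_ring.line_extension_def set_add_def set_mult_def r_coset_def)
  have "complex_ring.dimension (Suc 0) L (complex_ring.line_extension L 1 {0})"
    using complex_ring.Suc_dim[of 1 "{0}" 0 L] complex_ring.zero_dim[of L] by simp
  moreover have "complex_ring.line_extension L 1 {0} = L"
    by (auto simp: le)
  ultimately have "complex_ring.dimension (Suc 0) L L" by simp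
  hence "complex_ring.dimension (Suc (Suc 0)) L (complex_ring.line_extension L s L)"
    using not_in_base by (intro complex_ring.Suc_dim) auto
  moreover have "complex_ring.line_extension L s L = ext"
    by (auto simp: le ext_def add.commute)
  ultimately show ?thesis by (simp add: numeral_2_eq_2)
qed

section \<open>The Galois group of a quadratic extension\<close>

text \<open>The automorphism negating \<open>s\<close>, not complex conjugation \<open>cnj\<close>.
  Restricting it to \<open>ext\<close> makes it extensional, as \<open>Bij\<close> requires.\<close>

definition conj :: "complex \<Rightarrow> complex" where
  "conj = (\<lambda>x\<in>ext. THE y. \<exists>u\<in>L. \<exists>v\<in>L. x = u + v * s \<and> y = u - v * s)"

lemma conj_eq [simp]:
  assumes "u \<in> L" "v \<in> L"
  shows "conj (u + v * s) = u - v * s"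
proof -
  have "(THE y. \<exists>u'\<in>L. \<exists>v'\<in>L. u + v * s = u' + v' * s \<and> y = u' - v' * s) = u - v * s"
    using assms coords_eq_iff by (intro the_equality) auto
  thus ?thesis using extI[OF assms] by (simp add: conj_def)
qed

lemma conj_base: "u \<in> L \<Longrightarrow> conj u = u"
  using conj_eq[of u 0] by simp

lemma conj_s: "conj s = - s"
  using conj_eq[of 0 1] by simp

lemma conj_in_ext: "x \<in> ext \<Longrightarrow> conj x \<in> ext"
  using extI[of _ "- _"] by (auto elim!: extE)

lemma conj_conj: "x \<in> ext \<Longrightarrow> conj (conj x) = x"
  using conj_eq[of _ "- _"] by (auto elim!: extE)

lemma conj_mult:
  assumes "x \<in> ext" "y \<in> ext"
  shows "conj (x * y) = conj x * conj y"
proof -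
  obtain u v where x: "u \<in> L" "v \<in> L" "x = u + v * s" using assms(1) by (rule extE)
  obtain u' v' where y: "u' \<in> L" "v' \<in> L" "y = u' + v' * s" using assms(2) by (rule extE)
  have *: "x * y = (u * u' + v * v' * (s * s)) + (u * v' + v * u') * s"
    by (simp add: x y algebra_simps)
  have "conj (x * y) = (u * u' + v * v' * (s * s)) - (u * v' + v * u') * s"
    unfolding * using x y square_of_s by (intro conj_eq) auto
  also have "\<dots> = (u - v * s) * (u' - v' * s)" by (simp add: algebra_simps)
  also have "\<dots> = conj x * conj y" using x y by simp
  finally show ?thesis .
qed

lemma conj_add:
  assumes "x \<in> ext" "y \<in> ext"
  shows "conj (x + y) = conj x + conj y"
proof -
  obtain u v where x: "u \<in> L" "v \<in> L" "x = u + v * s" using assms(1) by (rule extE)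
  obtain u' v' where y: "u' \<in> L" "v' \<in> L" "y = u' + v' * s" using assms(2) by (rule extE)
  have *: "x + y = (u + u') + (v + v') * s"
    by (simp add: x y algebra_simps)
  have "conj (x + y) = (u + u') - (v + v') * s"
    unfolding * using x y by (intro conj_eq) auto
  also have "\<dots> = (u - v * s) + (u' - v' * s)" by (simp add: algebra_simps)
  also have "\<dots> = conj x + conj y" using x y by simp
  finally show ?thesis .
qed

lemma conj_Bij: "conj \<in> Bij ext"
proof -
  have "bij_betw conj ext ext"
    by (rule bij_betw_byWitness[where f' = conj]) (auto simp: conj_conj conj_in_ext)
  moreover have "conj \<in> extensional ext"
    by (auto simp: conj_def)
  ultimately show ?thesis by (simp add: Bij_def)
qed

text \<open>Since \<tau> s has the same square as s, it is s or -s. This value determines \<tau> on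
  L + L s, and extensional functions agreeing there are equal.\<close>

lemma galois_group_carrier: "carrier (galois_group L ext) = {\<lambda>x\<in>ext. x, conj}"
proof (intro equalityI subsetI)
  fix \<tau> assume "\<tau> \<in> carrier (galois_group L ext)"
  hence B: "\<tau> \<in> Bij ext" and hom: "\<tau> \<in> Ring.ring_hom (complex_ring\<lparr>carrier := ext\<rparr>) (complex_ring\<lparr>carrier := ext\<rparr>)"
    and fix_L: "\<And>x. x \<in> L \<Longrightarrow> \<tau> x = x"
    by (auto simp: galois_group_def)
  have mult: "\<tau> (x * y) = \<tau> x * \<tau> y" and add: "\<tau> (x + y) = \<tau> x + \<tau> y" if "x \<in> ext" "y \<in> ext" for x y
    using ring_hom_mult[OF hom, of x y] ring_hom_add[OF hom, of x y] that by auto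
  have "\<tau> s * \<tau> s = s * s"
    using mult[OF s_in_ext s_in_ext] fix_L[OF square_of_s] by simp
  hence "\<tau> s = s \<or> \<tau> s = - s" by (simp add: square_eq_iff)
  moreover have lin: "\<tau> (u + v * s) = u + v * \<tau> s" if "u \<in> L" "v \<in> L" for u v
    using that base_subset_ext s_in_ext by (auto simp: add mult ext_mult subset_iff fix_L)
  have "\<tau> = (\<lambda>x\<in>ext. x)" if "\<tau> s = s"
    by (rule extensionalityI[of _ ext])
      (use B lin that in \<open>auto simp: Bij_def elim!: extE\<close>)
  moreover have "\<tau> = conj" if "\<tau> s = - s"
    by (rule extensionalityI[of _ ext])
      (use B lin that conj_Bij in \<open>auto simp: Bij_def elim!: extE\<close>)
  ultimately show "\<tau> \<in> {\<lambda>x\<in>ext. x, conj}" by blast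
next
  fix \<tau> assume "\<tau> \<in> {\<lambda>x\<in>ext. x, conj}"
  thus "\<tau> \<in> carrier (galois_group L ext)"
    using base_subset_ext conj_Bij id_Bij[of ext]
    by (auto simp: galois_group_def Ring.ring_hom_def conj_base conj_mult conj_add conj_in_ext
        ext_mult ext_add subset_iff)
qed

lemma galois_group_mult:
  assumes "f \<in> carrier (galois_group L ext)" "g \<in> carrier (galois_group L ext)"
  shows "f \<otimes>\<^bsub>galois_group L ext\<^esub> g = compose ext f g"
  using assms by (simp add: galois_group_def BijGroup_def)

lemma compose_conj_conj: "compose ext conj conj = (\<lambda>x\<in>ext. x)"
  by (auto simp: compose_def conj_conj restrict_def fun_eq_iff)

lemma group_galois_group: "group (galois_group L ext)"
proof -
  have one: "\<one>\<^bsub>galois_group L ext\<^esub> = (\<lambda>x\<in>ext. x)"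
    by (simp add: galois_group_def BijGroup_def)
  have ce: "compose ext (\<lambda>x\<in>ext. x) conj = conj" "compose ext conj (\<lambda>x\<in>ext. x) = conj"
    "compose ext (\<lambda>x\<in>ext. x) (\<lambda>x\<in>ext. x) = (\<lambda>x\<in>ext. x)"
    using conj_Bij by (auto simp: Bij_def compose_def fun_eq_iff conj_in_ext extensional_def)
  show ?thesis
    by (rule groupI)
      (auto simp: galois_group_carrier galois_group_mult one ce compose_conj_conj)
qed

text \<open>In a group of order two only the non-identity element generates. The two automorphisms
  differ because s = -s would make s zero, hence an element of L.\<close>

lemma galois_generator_iff: "galois_generator L ext \<tau> \<longleftrightarrow> \<tau> = conj"
proof
  interpret G: group "galois_group L ext" by (rule group_galois_group)
  have one: "\<one>\<^bsub>galois_group L ext\<^esub> = (\<lambda>x\<in>ext. x)"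
    by (simp add: galois_group_def BijGroup_def)
  have ne: "conj \<noteq> (\<lambda>x\<in>ext. x)"
  proof
    assume "conj = (\<lambda>x\<in>ext. x)"
    hence "- s = s" using conj_s s_in_ext by (metis restrict_apply')
    thus False using not_in_base by auto
  qed
  {
    assume "\<tau> = conj"
    moreover have "generate (galois_group L ext) {conj} \<subseteq> carrier (galois_group L ext)"
      by (rule G.generate_incl) (simp add: galois_group_carrier)
    moreover have "carrier (galois_group L ext) \<subseteq> generate (galois_group L ext) {conj}"
      using generate.one[of "galois_group L ext" "{conj}"] generate.incl[of conj "{conj}" "galois_group L ext"]
      by (auto simp: galois_group_carrier one)
    ultimately show "galois_generator L ext \<tau>"
      by (auto simp: galois_generator_def galois_group_carrier)
  }
  assume gen: "galois_generator L ext \<tau>"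
  show "\<tau> = conj"
  proof (rule ccontr)
    assume "\<tau> \<noteq> conj"
    hence "\<tau> = \<one>\<^bsub>galois_group L ext\<^esub>"
      using gen by (auto simp: galois_generator_def galois_group_carrier one)
    hence "carrier (galois_group L ext) = {\<one>\<^bsub>galois_group L ext\<^esub>}"
      using gen G.generate_one by (simp add: galois_generator_def)
    thus False using ne by (auto simp: galois_group_carrier one)
  qed
qed

lemma cyclic_extension_ext: "cyclic_extension L ext 2"
proof -
  have "{x \<in> ext. \<forall>\<tau>\<in>carrier (galois_group L ext). \<tau> x = x} = L"
  proof (intro equalityI subsetI)
    fix x assume "x \<in> {x \<in> ext. \<forall>\<tau>\<in>carrier (galois_group L ext). \<tau> x = x}"
    hence x: "x \<in> ext" "conj x = x" by (auto simp: galois_group_carrier)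
    obtain u v where uv: "u \<in> L" "v \<in> L" "x = u + v * s" using x(1) by (rule extE)
    have "v * s = 0" using x(2) uv by auto
    with uv show "x \<in> L" by (simp only: add_0_right)
  qed (use base_subset_ext in \<open>auto simp: galois_group_carrier conj_base\<close>)
  thus ?thesis
    using subfield_base subfield_ext base_subset_ext dimension_ext galois_generator_iff
    by (auto simp: cyclic_extension_def galois_extension_def)
qed

text \<open>An automorphism fixing the integers sends roots of an integer polynomial to roots of the
  same polynomial.\<close>

lemma algebraic_int_conj:
  assumes "x \<in> ext" "algebraic_int x"
  shows "algebraic_int (conj x)"
proof -
  obtain q where q: "poly (map_poly of_int q) x = 0" "lead_coeff q = 1"
    using assms(2) unfolding algebraic_int_altdef_ipoly by auto
  have Z: "of_int k \<in> L" for k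
    using Rats_subset_subfield[OF subfield_base] by auto
  \<comment> \<open>Membership in \<open>ext\<close> is carried through the induction because
    \<open>conj_add\<close> and \<open>conj_mult\<close> are available only there.\<close>
  have "poly (map_poly of_int q) x \<in> ext \<and>
        conj (poly (map_poly of_int q) x) = poly (map_poly of_int q) (conj x)"
  proof (induction q)
    case 0
    show ?case using base_subset_ext by (auto simp: conj_base)
  next
    case (pCons a q)
    thus ?case using Z[of a] base_subset_ext assms(1)
      by (auto simp: map_poly_pCons conj_add conj_mult conj_base ext_mult ext_add subset_iff)
  qed
  with q have "poly (map_poly of_int q) (conj x) = 0" by (simp add: conj_base)
  with q(2) show ?thesis unfolding algebraic_int_altdef_ipoly by auto
qed

end

section \<open>Rings of integers\<close>

lemma Rats_complex_eq: "(\<rat> :: complex set) = of_real ` \<rat>"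
proof (intro equalityI subsetI)
  fix x :: complex assume "x \<in> \<rat>"
  then obtain a b where "x = of_int a / of_int b" "b \<noteq> 0" by (auto elim!: Rats_cases')
  hence "x = of_real (of_int a / of_int b)" by simp
  thus "x \<in> of_real ` \<rat>" by (rule image_eqI) simp
next
  fix x :: complex assume "x \<in> of_real ` \<rat>"
  then obtain a b where "x = of_real (of_int a / of_int b)" "b \<noteq> 0" by (auto elim!: Rats_cases')
  thus "x \<in> \<rat>" by simp
qed

lemma subfield_Rats: "subfield \<rat> complex_ring"
  by (auto simp: subfield_complex_ring_iff)

lemma Rats_eq_generate_field: "\<rat> = generate_field complex_ring {}"
  by (rule field.generate_fieldI[OF field_complex_ring])
    (auto simp: subfield_Rats dest: Rats_subset_subfield)

interpretation Q_i: quadratic_extension "\<rat>" "\<i>"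
proof (rule quadratic_extension.intro)
  show "\<i> \<notin> \<rat>"
    by (auto simp: Rats_complex_eq complex_eq_iff)
qed (simp_all add: subfield_Rats)

lemma Q_adjoin_ii: "Q_adjoin {\<i>} = Q_i.ext"
  unfolding Q_adjoin_def using Q_i.ext_eq_generate_field[OF Rats_eq_generate_field] by simp

lemma Q_ii_iff: "z \<in> Q_i.ext \<longleftrightarrow> Re z \<in> \<rat> \<and> Im z \<in> \<rat>"
proof
  assume "z \<in> Q_i.ext"
  then obtain u v where "u \<in> \<rat>" "v \<in> \<rat>" "z = u + v * \<i>" by (rule Q_i.extE)
  thus "Re z \<in> \<rat> \<and> Im z \<in> \<rat>"
    unfolding Rats_complex_eq by auto
next
  assume *: "Re z \<in> \<rat> \<and> Im z \<in> \<rat>"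
  hence "of_real (Re z) \<in> (\<rat> :: complex set)" "of_real (Im z) \<in> (\<rat> :: complex set)"
    by (auto simp: Rats_complex_eq)
  from Q_i.extI[OF this] show "z \<in> Q_i.ext"
    using complex_eq[of z] by (simp add: mult.commute)
qed

lemma algebraic_int_of_int: "algebraic_int (of_int k)"
  by (rule int_imp_algebraic_int) simp

lemma int_square_mod_4: "n\<^sup>2 mod 4 = n mod 2" for n :: int
proof (cases "even n")
  case True thus ?thesis by (auto elim!: evenE simp: power2_eq_square)
next
  case False
  then obtain k where "n = 2 * k + 1" by (elim oddE)
  hence "n\<^sup>2 = 4 * (k\<^sup>2 + k) + 1" by (simp add: power2_eq_square algebra_simps)
  hence "n\<^sup>2 mod 4 = 1" by presburger
  thus ?thesis using False by presburger
qed

lemma even_if_dvd_sum_squares: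
  fixes a b :: int
  assumes "4 dvd a\<^sup>2 + b\<^sup>2"
  shows "even a \<and> even b"
  using int_square_mod_4[of a] int_square_mod_4[of b] assms by presburger

text \<open>For an integral z in Q(i), the numbers 2 Re z, 2 Im z and |z|^2 are rational algebraic
  integers, hence integers. The squares of the first two then sum to a multiple of 4, which forces
  both to be even.\<close>

lemma ring_of_integers_Q_ii: "ring_of_integers Q_i.ext = gauss_ints"
proof (intro equalityI subsetI)
  fix z assume "z \<in> gauss_ints"
  then obtain a b where z: "z = of_int a + of_int b * \<i>" by (rule gauss_intsE)
  show "z \<in> ring_of_integers Q_i.ext"
    unfolding ring_of_integers_def z
    by (auto intro!: algebraic_int_add algebraic_int_mult algebraic_int_of_int Q_i.extI)
next
  fix z assume "z \<in> ring_of_integers Q_i.ext"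
  hence R: "Re z \<in> \<rat>" "Im z \<in> \<rat>" and z: "algebraic_int z"
    by (auto simp: ring_of_integers_def Q_ii_iff)
  have cz: "algebraic_int (cnj z)" using z by simp
  have of_real_int: "x \<in> \<int>" if "algebraic_int (of_real x :: complex)" "x \<in> \<rat>" for x :: real
    using rational_algebraic_int_is_int that by auto
  have "z + cnj z = of_real (2 * Re z)" by (simp add: complex_add_cnj)
  hence "algebraic_int (of_real (2 * Re z) :: complex)"
    using algebraic_int_add[OF z cz] by simp
  hence "2 * Re z \<in> \<int>" using R by (intro of_real_int) auto
  then obtain a where a: "2 * Re z = of_int a" by (elim Ints_cases)
  have "- \<i> * (z - cnj z) = of_real (2 * Im z)" by (simp add: complex_eq_iff)
  moreover have "algebraic_int (- \<i> * (z - cnj z))"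
    by (intro algebraic_int_mult algebraic_int_diff z cz) auto
  ultimately have "algebraic_int (of_real (2 * Im z) :: complex)" by simp
  hence "2 * Im z \<in> \<int>" using R by (intro of_real_int) auto
  then obtain b where b: "2 * Im z = of_int b" by (elim Ints_cases)
  have "z * cnj z = of_real ((Re z)\<^sup>2 + (Im z)\<^sup>2)" by (rule complex_mult_cnj)
  hence "algebraic_int (of_real ((Re z)\<^sup>2 + (Im z)\<^sup>2) :: complex)"
    using algebraic_int_mult[OF z cz] by simp
  hence "(Re z)\<^sup>2 + (Im z)\<^sup>2 \<in> \<int>" using R by (intro of_real_int) auto
  then obtain c where c: "(Re z)\<^sup>2 + (Im z)\<^sup>2 = of_int c" by (elim Ints_cases)
  have "(of_int (a\<^sup>2 + b\<^sup>2) :: real) = of_int (4 * c)"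
    by (simp flip: a b c add: power_mult_distrib)
  hence "a\<^sup>2 + b\<^sup>2 = 4 * c" by (simp only: of_int_eq_iff)
  hence "even a \<and> even b" by (intro even_if_dvd_sum_squares) simp
  then obtain a' b' where "a = 2 * a'" "b = 2 * b'" by (auto elim!: evenE)
  thus "z \<in> gauss_ints" using a b by (simp add: gauss_ints_def)
qed

text \<open>Compare coordinate parities. The imaginary part of the hypothesis separates two odd
  coordinates from all other cases; the real part, a difference of squares equal to 0, 1 or -1
  modulo 4, tells which coordinate is odd when exactly one is.\<close>

lemma gauss_ints_half_diff:
  assumes "a \<in> gauss_ints" "b \<in> gauss_ints" "(a\<^sup>2 - b\<^sup>2) / 4 \<in> gauss_ints"
  shows "(a - b) / 2 \<in> gauss_ints"
proof -
  obtain a1 a2 where a: "a = of_int a1 + of_int a2 * \<i>" using assms(1) by (rule gauss_intsE)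
  obtain b1 b2 where b: "b = of_int b1 + of_int b2 * \<i>" using assms(2) by (rule gauss_intsE)
  obtain q1 q2 where "(a\<^sup>2 - b\<^sup>2) / 4 = of_int q1 + of_int q2 * \<i>"
    using assms(3) by (rule gauss_intsE)
  hence "a\<^sup>2 - b\<^sup>2 = 4 * (of_int q1 + of_int q2 * \<i>)" by (simp add: field_simps)
  hence "of_int (a1\<^sup>2 - a2\<^sup>2 - b1\<^sup>2 + b2\<^sup>2) = (of_int (4 * q1) :: real)"
    "of_int (2 * (a1 * a2) - 2 * (b1 * b2)) = (of_int (4 * q2) :: real)"
    by (auto simp: a b complex_eq_iff power2_eq_square algebra_simps)
  hence e1: "a1\<^sup>2 - a2\<^sup>2 - b1\<^sup>2 + b2\<^sup>2 = 4 * q1" and e2: "2 * (a1 * a2) - 2 * (b1 * b2) = 4 * q2"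
    by (simp_all only: of_int_eq_iff)
  have sq: "even n \<and> n\<^sup>2 mod 4 = 0 \<or> odd n \<and> n\<^sup>2 mod 4 = 1" for n :: int
    using int_square_mod_4[of n] by presburger
  have "a1 * a2 = b1 * b2 + 2 * q2" using e2 by simp
  hence "even (a1 * a2) \<longleftrightarrow> even (b1 * b2)" by simp
  hence "even a1 \<or> even a2 \<longleftrightarrow> even b1 \<or> even b2" by simp
  hence "even (a1 - b1) \<and> even (a2 - b2)"
    using sq[of a1] sq[of a2] sq[of b1] sq[of b2] e1 even_diff by (elim disjE conjE; presburger)
  thus ?thesis using gauss_ints_divide_of_int[of 2 "a1 - b1" "a2 - b2"]
    by (simp add: a b algebra_simps)
qed

section \<open>The integers of Q(i, sqrt p)\<close>

locale prime_5_mod_8 =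
  fixes p :: nat
  assumes prime: "prime p" and mod_8: "p mod 8 = 5"
begin

abbreviation sqrt_p :: complex where
  "sqrt_p \<equiv> of_real (sqrt (real p))"

lemma p_pos: "p > 0"
  using prime prime_gt_0_nat by blast

lemma sqrt_p_square: "sqrt_p * sqrt_p = of_nat p"
  by (simp flip: of_real_mult)

text \<open>Otherwise sqrt p would be a rational algebraic integer, hence an integer, and the prime
  \<open>p\<close> a square.\<close>

lemma sqrt_p_not_in_Q_ii: "sqrt_p \<notin> Q_i.ext"
proof
  assume "sqrt_p \<in> Q_i.ext"
  hence "sqrt (real p) \<in> \<rat>" by (simp add: Q_ii_iff)
  moreover have "algebraic_int (sqrt (real p))"
    by (intro algebraic_int_sqrt int_imp_algebraic_int) auto
  ultimately have "sqrt (real p) \<in> \<int>"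
    by (intro rational_algebraic_int_is_int)
  then obtain n where n: "sqrt (real p) = of_int n" by (elim Ints_cases)
  have "real_of_int (n\<^sup>2) = real p" by (simp flip: n)
  hence "n\<^sup>2 = int p" by linarith
  hence "(nat \<bar>n\<bar>)\<^sup>2 = p" by (metis nat_abs_mult_distrib nat_int power2_eq_square abs_of_nat abs_power2)
  thus False using prime by (auto simp: prime_power_iff)
qed

sublocale quadratic_extension Q_i.ext sqrt_p
proof (rule quadratic_extension.intro)
  show "subfield Q_i.ext complex_ring" by (rule Q_i.subfield_ext)
  show "sqrt_p\<^sup>2 \<in> Q_i.ext" by (simp add: Q_ii_iff power2_eq_square sqrt_p_square)
  show "sqrt_p \<notin> Q_i.ext" by (rule sqrt_p_not_in_Q_ii)
qed

lemma Q_adjoin_ii_sqrt_p: "Q_adjoin {\<i>, sqrt_p} = ext"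
  using ext_eq_generate_field[of "{\<i>}"] Q_adjoin_ii
  by (simp add: Q_adjoin_def insert_commute)

lemma gauss_int_in_base: "x \<in> gauss_ints \<Longrightarrow> x \<in> Q_i.ext"
  using ring_of_integers_Q_ii by (auto simp: ring_of_integers_def)

lemma algebraic_int_gauss_int: "x \<in> gauss_ints \<Longrightarrow> algebraic_int x"
  using ring_of_integers_Q_ii by (auto simp: ring_of_integers_def)

lemma base_algebraic_int: "x \<in> Q_i.ext \<Longrightarrow> algebraic_int x \<Longrightarrow> x \<in> gauss_ints"
  using ring_of_integers_Q_ii by (auto simp: ring_of_integers_def)

text \<open>Chosen so that X^2 - X - k has the root (1 + sqrt p)/2.\<close>

definition k :: nat where "k = p div 4"

lemma p_eq: "p = 4 * k + 1"
  using mod_8 unfolding k_def by presburger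

lemma algebraic_int_half: "algebraic_int ((1 + sqrt_p) / 2)"
proof -
  have "poly (map_poly of_int [:- int k, - 1, 1:]) ((1 + sqrt_p) / 2) =
        (sqrt_p * sqrt_p - 1) / 4 - of_nat k"
    by (simp add: field_simps)
  also have "\<dots> = 0" unfolding sqrt_p_square by (subst p_eq) simp
  finally show ?thesis unfolding algebraic_int_altdef_ipoly
    by (intro exI[of _ "[:- int k, - 1, 1:]"]) simp
qed

lemma two_in_base: "2 \<in> Q_i.ext"
  by (simp add: Q_ii_iff)

lemma half_in_base_iff: "u / 2 \<in> Q_i.ext \<longleftrightarrow> u \<in> Q_i.ext"
proof
  assume "u / 2 \<in> Q_i.ext"
  from mult_in_base[OF two_in_base this] show "u \<in> Q_i.ext" by simp
qed (rule divide_in_base[OF _ two_in_base])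

lemma double_in_base_iff: "2 * u \<in> Q_i.ext \<longleftrightarrow> u \<in> Q_i.ext"
  using half_in_base_iff[of "2 * u"] by simp

lemma half_eq_coords: "(a + b * sqrt_p) / 2 = a / 2 + b / 2 * sqrt_p"
  by (simp add: add_divide_distrib)

lemma conj_half:
  assumes "a \<in> gauss_ints" "b \<in> gauss_ints"
  shows "conj ((a + b * sqrt_p) / 2) = (a - b * sqrt_p) / 2"
proof -
  have "a / 2 \<in> Q_i.ext" "b / 2 \<in> Q_i.ext"
    using assms gauss_int_in_base half_in_base_iff by simp_all
  from conj_eq[OF this] show ?thesis
    by (simp add: half_eq_coords diff_divide_distrib)
qed

text \<open>This is the relative norm: u^2 - p v^2 lies in Q(i) and is a product of two integral
  numbers.\<close>

lemma norm_in_gauss_ints: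
  assumes "x \<in> ring_of_integers ext"
  shows "x * conj x \<in> gauss_ints"
proof (rule base_algebraic_int)
  have x: "x \<in> ext" "algebraic_int x" using assms by (auto simp: ring_of_integers_def)
  show "algebraic_int (x * conj x)"
    using x by (intro algebraic_int_mult algebraic_int_conj)
  obtain u v where uv: "u \<in> Q_i.ext" "v \<in> Q_i.ext" "x = u + v * sqrt_p" using x(1) by (rule extE)
  have "x * conj x = u * u - (v * v) * (sqrt_p * sqrt_p)"
    using uv by (simp add: algebra_simps)
  also have "\<dots> \<in> Q_i.ext" using uv square_of_s by auto
  finally show "x * conj x \<in> Q_i.ext" .
qed

text \<open>In classical terms the ring is Z[i][(1 + sqrt p)/2]. Trace and norm show 2u and u^2 - p
  v^2 to be Gaussian integers; it remains to remove \<open>p\<close> from the denominator of 2v and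
  to compare parities.\<close>

lemma ring_of_integers_ext_iff:
  "x \<in> ring_of_integers ext \<longleftrightarrow>
     (\<exists>a\<in>gauss_ints. \<exists>b\<in>gauss_ints. x = (a + b * sqrt_p) / 2 \<and> (a - b) / 2 \<in> gauss_ints)"
proof
  assume "\<exists>a\<in>gauss_ints. \<exists>b\<in>gauss_ints. x = (a + b * sqrt_p) / 2 \<and> (a - b) / 2 \<in> gauss_ints"
  then obtain a b where ab: "a \<in> gauss_ints" "b \<in> gauss_ints" "(a - b) / 2 \<in> gauss_ints"
    and x: "x = (a + b * sqrt_p) / 2" by blast
  have "x = (a - b) / 2 + b * ((1 + sqrt_p) / 2)"
    unfolding x by (simp add: algebra_simps add_divide_distrib diff_divide_distrib)
  moreover have "algebraic_int ((a - b) / 2 + b * ((1 + sqrt_p) / 2))"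
    by (rule algebraic_int_add[OF algebraic_int_gauss_int[OF ab(3)]
          algebraic_int_mult[OF algebraic_int_gauss_int[OF ab(2)] algebraic_int_half]])
  ultimately have "algebraic_int x" by simp
  moreover have "x \<in> ext"
    unfolding x half_eq_coords using ab gauss_int_in_base half_in_base_iff by (intro extI) simp_all
  ultimately show "x \<in> ring_of_integers ext" by (simp add: ring_of_integers_def)
next
  assume xO: "x \<in> ring_of_integers ext"
  hence x: "x \<in> ext" "algebraic_int x" by (auto simp: ring_of_integers_def)
  obtain u v where uv: "u \<in> Q_i.ext" "v \<in> Q_i.ext" "x = u + v * sqrt_p" using x(1) by (rule extE)
  have cx: "conj x = u - v * sqrt_p" using uv by simp
  have "x + conj x = 2 * u" unfolding cx by (simp add: uv(3))
  hence a: "2 * u \<in> gauss_ints"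
    using base_algebraic_int[of "2 * u"] uv(1) double_in_base_iff[of u]
      algebraic_int_add[OF x(2) algebraic_int_conj[OF x]] by simp
  \<comment> \<open>The factor sqrt p brings x - conj x into the base field, at the price of a
    factor \<open>p\<close> to be divided out afterwards.\<close>
  have "(x - conj x) * sqrt_p = 2 * (v * (sqrt_p * sqrt_p))"
    unfolding cx by (simp add: uv(3) algebra_simps)
  hence e: "(x - conj x) * sqrt_p = 2 * v * of_nat p" unfolding sqrt_p_square by simp
  have "algebraic_int sqrt_p"
    by (intro algebraic_int_of_real algebraic_int_sqrt int_imp_algebraic_int) auto
  hence "algebraic_int (2 * v * of_nat p)"
    unfolding e[symmetric] using x by (intro algebraic_int_mult algebraic_int_diff algebraic_int_conj)
  hence m: "2 * v * of_nat p \<in> gauss_ints"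
    using uv(2) gauss_int_in_base[of "of_nat p"]
    by (intro base_algebraic_int) (simp_all add: double_in_base_iff mult_in_base)
  have "x * conj x = u * u - v * v * (sqrt_p * sqrt_p)"
    unfolding cx by (simp add: uv(3) algebra_simps)
  hence N: "u\<^sup>2 - of_nat p * v\<^sup>2 \<in> gauss_ints"
    using norm_in_gauss_ints[OF xO] unfolding sqrt_p_square by (simp add: power2_eq_square mult_ac)
  \<comment> \<open>With \<open>w = 0\<close> the divisibility lemma says that \<open>p\<close>
    divides z once it divides z^2; here z is 2 v p.\<close>
  have "((2 * v * of_nat p)\<^sup>2 - \<i> * 0\<^sup>2) / of_nat p = (2 * u)\<^sup>2 - 4 * (u\<^sup>2 - of_nat p * v\<^sup>2)"
    using p_pos by (simp add: power2_eq_square field_simps)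
  also have "\<dots> \<in> gauss_ints" by (simp only: gauss_ints_closed a N)
  finally have "2 * v * of_nat p / of_nat p \<in> gauss_ints"
    using gauss_int_dvd_if_square_diff[OF prime mod_8 m gauss_ints_closed(1)] by blast
  hence b: "2 * v \<in> gauss_ints" using p_pos by simp
  \<comment> \<open>Since p = 1 modulo 4, integrality of the norm makes the squares of 2u and 2v
    congruent modulo 4.\<close>
  have "((2 * u)\<^sup>2 - (2 * v)\<^sup>2) / 4 = (u\<^sup>2 - of_nat p * v\<^sup>2) + of_nat k * (2 * v)\<^sup>2"
    by (subst p_eq) (simp add: field_simps)
  also have "\<dots> \<in> gauss_ints" by (simp only: gauss_ints_closed N b)
  finally have "(2 * u - 2 * v) / 2 \<in> gauss_ints"
    by (rule gauss_ints_half_diff[OF a b])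
  thus "\<exists>a\<in>gauss_ints. \<exists>b\<in>gauss_ints. x = (a + b * sqrt_p) / 2 \<and> (a - b) / 2 \<in> gauss_ints"
    using a b uv(3) by (intro bexI[of _ "2 * u"] bexI[of _ "2 * v"]) auto
qed

end

section \<open>The code\<close>

lemma mat_adjoint_index:
  assumes "A \<in> carrier_mat n m" "i < m" "j < n"
  shows "mat_adjoint A $$ (i, j) = conjugate (A $$ (j, i))"
  using assms by (auto simp: mat_adjoint_def mat_of_rows_def)

lemma mat_adjoint_carrier: "A \<in> carrier_mat n m \<Longrightarrow> mat_adjoint A \<in> carrier_mat m n"
  by (auto simp: mat_adjoint_def)

lemma det_mat_2:
  fixes f :: "nat \<times> nat \<Rightarrow> 'a :: comm_ring_1"
  shows "det (mat 2 2 f) = f (0, 0) * f (1, 1) - f (0, 1) * f (1, 0)"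
proof -
  have A: "mat 2 2 f \<in> carrier_mat 2 2" by simp
  have sub: "mat_delete (mat 2 2 f) 0 j \<in> carrier_mat 1 1" for j
    using mat_delete_carrier[OF A, of 0 j] by simp
  have "det (mat 2 2 f) = (\<Sum>j<2. mat 2 2 f $$ (0, j) * cofactor (mat 2 2 f) 0 j)"
    by (rule laplace_expansion_row[OF A]) simp
  thus ?thesis
    by (simp add: numeral_2_eq_2 cofactor_def det_single sub mat_delete_def)
qed

context prime_5_mod_8
begin

section \<open>Codewords and their determinants\<close>

lemma layer_element_2: "layer_element 2 \<nu> u l = u (l, 0) * \<nu> 0 + u (l, 1) * \<nu> 1"
  by (simp add: layer_element_def numeral_2_eq_2)

text \<open>Only the entry in row 1, column 0 wraps around; there the layer index
  \<open>s + n - r\<close> is 1.\<close>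

lemma codeword_2:
  "codeword 2 conj \<i> \<nu> c u =
     complex_of_real (1 / sqrt c) \<cdot>\<^sub>m mat 2 2 (\<lambda>(r, s).
       if r = 0 then layer_element 2 \<nu> u s
       else if s = 0 then \<i> * conj (layer_element 2 \<nu> u 1) else conj (layer_element 2 \<nu> u 0))"
  unfolding codeword_def
  by (intro arg_cong[where f = "\<lambda>M. _ \<cdot>\<^sub>m M"] eq_matI) (auto simp: less_2_cases_iff)

lemma det_codeword_2:
  assumes "c > 0"
  shows "det (codeword 2 conj \<i> \<nu> c u) =
    (layer_element 2 \<nu> u 0 * conj (layer_element 2 \<nu> u 0) -
     \<i> * (layer_element 2 \<nu> u 1 * conj (layer_element 2 \<nu> u 1))) / of_real c"
proof -
  have "complex_of_real (1 / sqrt c) ^ 2 = 1 / of_real c"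
    using assms by (simp add: power_divide flip: of_real_power)
  thus ?thesis
    by (simp add: codeword_2 det_mat_2 algebra_simps diff_divide_distrib)
qed

text \<open>Doubling both elements clears denominators, and four times each norm is a value of the
  form a^2 - p b^2, so anisotropy of the quaternion norm form applies. It makes codeword
  determinants nonzero.\<close>

lemma norm_nonzero:
  assumes x: "x \<in> ring_of_integers ext" and y: "y \<in> ring_of_integers ext"
    and eq: "x * conj x = \<i> * (y * conj y)"
  shows "x = 0 \<and> y = 0"
proof -
  obtain a b where ab: "a \<in> gauss_ints" "b \<in> gauss_ints" and x: "x = (a + b * sqrt_p) / 2"
    using x by (auto simp: ring_of_integers_ext_iff)
  obtain c d where cd: "c \<in> gauss_ints" "d \<in> gauss_ints" and y: "y = (c + d * sqrt_p) / 2"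
    using y by (auto simp: ring_of_integers_ext_iff)
  have N: "(u + v * sqrt_p) / 2 * conj ((u + v * sqrt_p) / 2) = (u\<^sup>2 - of_nat p * v\<^sup>2) / 4"
    if "u \<in> gauss_ints" "v \<in> gauss_ints" for u v
    unfolding conj_half[OF that] sqrt_p_square[symmetric] by (simp add: field_simps power2_eq_square)
  have "a\<^sup>2 - of_nat p * b\<^sup>2 = \<i> * (c\<^sup>2 - of_nat p * d\<^sup>2)"
    using eq unfolding x y N[OF ab] N[OF cd] by (simp add: field_simps)
  hence "a = 0 \<and> b = 0 \<and> c = 0 \<and> d = 0"
    by (rule quaternion_norm_form_anisotropic[OF prime mod_8 ab cd])
  thus ?thesis by (simp add: x y)
qed

section \<open>Ideals of the ring of integers\<close>

lemma ring_of_integers_ext_closed: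
  assumes "x \<in> ring_of_integers ext" "y \<in> ring_of_integers ext"
  shows "x + y \<in> ring_of_integers ext" "x * y \<in> ring_of_integers ext"
    "- x \<in> ring_of_integers ext"
  using assms ext_diff[of 0 x] subsetD[OF base_subset_ext zero_in_base]
  by (auto simp: ring_of_integers_def algebraic_int_add algebraic_int_mult ext_add ext_mult)

lemma gauss_int_in_ring_of_integers: "x \<in> gauss_ints \<Longrightarrow> x \<in> ring_of_integers ext"
  using gauss_int_in_base algebraic_int_gauss_int base_subset_ext
  by (auto simp: ring_of_integers_def)

lemma ring_ring_of_integers: "ring (complex_ring\<lparr>carrier := ring_of_integers ext\<rparr>)"
  by (rule complex_ring.subring_is_ring, rule complex_ring.subringI)
    (auto intro: ring_of_integers_ext_closed gauss_int_in_ring_of_integers)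

text \<open>Negatives come from multiplication by -1, so sums and multiples suffice.\<close>

lemma idealI_ring_of_integers:
  assumes sub: "I \<subseteq> ring_of_integers ext" and zero: "0 \<in> I"
    and add: "\<And>x y. x \<in> I \<Longrightarrow> y \<in> I \<Longrightarrow> x + y \<in> I"
    and mult: "\<And>x y. x \<in> ring_of_integers ext \<Longrightarrow> y \<in> I \<Longrightarrow> x * y \<in> I"
  shows "ideal I (complex_ring\<lparr>carrier := ring_of_integers ext\<rparr>)"
proof -
  let ?R = "complex_ring\<lparr>carrier := ring_of_integers ext\<rparr>"
  interpret R: ring ?R by (rule ring_ring_of_integers)
  have neg: "\<ominus>\<^bsub>?R\<^esub> x = - x" if "x \<in> ring_of_integers ext" for x
    using that ring_of_integers_ext_closed(3)[OF that that] by (intro R.minus_equality) auto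
  show ?thesis
  proof (rule idealI[OF R.ring_axioms])
    show "subgroup I (add_monoid ?R)"
    proof (rule R.add.subgroupI)
      fix x assume x: "x \<in> I"
      have "- 1 \<in> ring_of_integers ext" by (intro gauss_int_in_ring_of_integers) simp
      from mult[OF this x] show "\<ominus>\<^bsub>?R\<^esub> x \<in> I"
        using neg[of x] x sub by auto
    qed (use sub zero add in auto)
    fix a x assume "a \<in> I" "x \<in> carrier ?R"
    thus "x \<otimes>\<^bsub>?R\<^esub> a \<in> I" "a \<otimes>\<^bsub>?R\<^esub> x \<in> I"
      using mult[of x a] by (simp_all add: mult.commute)
  qed
qed

section \<open>The explicit ideal, basis and code\<close>

lemma perfect_code_exists:
  "\<exists>I \<nu>. nonzero_ideal I ext \<and> integral_basis Q_i.ext 2 \<nu> I \<and>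
     perfect_code Q_i.ext 2 conj \<i> \<nu> (real p)"
proof -
  obtain A B :: int where AB: "int p = (2 * A - 1)\<^sup>2 + (2 * B)\<^sup>2"
  proof (rule prime_1_mod_4_odd_even_two_squares[OF prime])
    show "p mod 4 = 1" using mod_8 by presburger
  qed
  define \<pi> :: complex where "\<pi> = of_int (2 * A - 1) + of_int (2 * B) * \<i>"
  have pi_int: "\<pi> \<in> gauss_ints" unfolding \<pi>_def by simp
  have pi_norm: "\<pi> * cnj \<pi> = of_nat p"
  proof -
    have "\<pi> * cnj \<pi> = of_int ((2 * A - 1)\<^sup>2 + (2 * B)\<^sup>2)"
      by (simp add: \<pi>_def complex_eq_iff power2_eq_square)
    also have "\<dots> = of_nat p" unfolding AB[symmetric] by simp
    finally show ?thesis .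
  qed
  have pi0: "\<pi> \<noteq> 0" using pi_norm p_pos by auto
  \<comment> \<open>The coefficients \<pi> and 1, respectively \<pi> and -1, agree modulo 2, which
    is the integrality criterion.\<close>
  define \<alpha> where "\<alpha> = (\<pi> + sqrt_p) / 2"
  define \<beta> where "\<beta> = (\<pi> - sqrt_p) / 2"
  define \<nu> :: "nat \<Rightarrow> complex" where "\<nu> = (\<lambda>k. if k = 0 then \<alpha> else \<beta>)"
  have nu: "\<nu> 0 = \<alpha>" "\<nu> 1 = \<beta>" "\<nu> (Suc 0) = \<beta>" by (simp_all add: \<nu>_def)
  have conj_alpha: "conj \<alpha> = \<beta>"
    using conj_half[OF pi_int, of 1] by (simp add: \<alpha>_def \<beta>_def)
  have conj_beta: "conj \<beta> = \<alpha>"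
    using conj_half[OF pi_int, of "- 1"] by (simp add: \<alpha>_def \<beta>_def)
  have alpha: "\<alpha> \<in> ring_of_integers ext"
    unfolding ring_of_integers_ext_iff
    by (rule bexI[OF _ pi_int], rule bexI[of _ 1]) (simp_all add: \<alpha>_def, simp add: \<pi>_def diff_divide_distrib add_divide_distrib)
  have beta: "\<beta> \<in> ring_of_integers ext"
    unfolding ring_of_integers_ext_iff
    by (rule bexI[OF _ pi_int], rule bexI[of _ "- 1"]) (simp_all add: \<beta>_def, simp add: \<pi>_def diff_divide_distrib add_divide_distrib)
  define I where "I = {a * \<alpha> + b * \<beta> | a b. a \<in> gauss_ints \<and> b \<in> gauss_ints}"
  have II: "a * \<alpha> + b * \<beta> \<in> I" if "a \<in> gauss_ints" "b \<in> gauss_ints" for a b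
    using that by (auto simp: I_def)
  have IE: "\<exists>a\<in>gauss_ints. \<exists>b\<in>gauss_ints. x = a * \<alpha> + b * \<beta>" if "x \<in> I" for x
    using that by (auto simp: I_def)
  have I_sub: "I \<subseteq> ring_of_integers ext"
    unfolding I_def using alpha beta ring_of_integers_ext_closed gauss_int_in_ring_of_integers
    by fastforce
  have indep: "a = 0 \<and> b = 0" if "a \<in> gauss_ints" "b \<in> gauss_ints" "a * \<alpha> + b * \<beta> = 0" for a b
  proof -
    \<comment> \<open>Passing to the coordinates with respect to 1 and sqrt p, which are independent
      over Q(i).\<close>
    have "(a + b) * \<pi> + (a - b) * sqrt_p = 2 * (a * \<alpha> + b * \<beta>)"
      by (simp add: \<alpha>_def \<beta>_def field_simps)
    also have "\<dots> = 0" using that by simp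
    finally have "(a + b) * \<pi> = 0 \<and> a - b = 0"
      using that pi_int gauss_int_in_base by (intro coords_zero) simp_all
    thus ?thesis using pi0 by auto
  qed

  \<comment> \<open>For x \<alpha> + y \<beta> the coordinates give x + y and x - y. Using p = \<pi>
    \<open>cnj\<close> \<pi>, these are (1 + \<open>cnj\<close> \<pi>)/2 = A - B i and (1 + \<pi>)/2
    = A + B i for the first product, and (1 - \<open>cnj\<close> \<pi>)/2 and (\<pi> - 1)/2 for the
    second.\<close>
  have half_alpha: "(1 + sqrt_p) / 2 * \<alpha> = of_int A * \<alpha> + (- of_int B * \<i>) * \<beta>" (is "?\<theta> * _ = _")
    and half_beta: "(1 + sqrt_p) / 2 * \<beta> = (of_int B * \<i>) * \<alpha> + (1 - of_int A) * \<beta>"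
  proof -
    have P: "sqrt_p * sqrt_p = (of_int (2 * A - 1))\<^sup>2 + (of_int (2 * B))\<^sup>2"
      unfolding sqrt_p_square by (metis AB of_int_add of_int_of_nat_eq of_int_power)
    have "4 * (?\<theta> * \<alpha>) = \<pi> + sqrt_p * sqrt_p + (1 + \<pi>) * sqrt_p"
      by (simp add: \<alpha>_def field_simps)
    also have "\<dots> = 2 * of_int A * (\<pi> + sqrt_p) - 2 * of_int B * \<i> * (\<pi> - sqrt_p)"
      unfolding P by (simp add: \<pi>_def algebra_simps power2_eq_square)
    also have "\<dots> = 4 * (of_int A * \<alpha> + (- of_int B * \<i>) * \<beta>)"
      by (simp add: \<alpha>_def \<beta>_def)
    finally show "?\<theta> * \<alpha> = of_int A * \<alpha> + (- of_int B * \<i>) * \<beta>"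
      by (subst (asm) mult_left_cancel) simp_all
    have "4 * (?\<theta> * \<beta>) = \<pi> - sqrt_p * sqrt_p + (\<pi> - 1) * sqrt_p"
      by (simp add: \<beta>_def field_simps)
    also have "\<dots> = 2 * of_int B * \<i> * (\<pi> + sqrt_p) + 2 * (1 - of_int A) * (\<pi> - sqrt_p)"
      unfolding P by (simp add: \<pi>_def algebra_simps power2_eq_square)
    also have "\<dots> = 4 * ((of_int B * \<i>) * \<alpha> + (1 - of_int A) * \<beta>)"
      by (simp add: \<alpha>_def \<beta>_def)
    finally show "?\<theta> * \<beta> = (of_int B * \<i>) * \<alpha> + (1 - of_int A) * \<beta>"
      by (subst (asm) mult_left_cancel) simp_all
  qed
  have I_mult: "x * y \<in> I" if x: "x \<in> ring_of_integers ext" and y: "y \<in> I" for x y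
  proof -
    obtain c d where cd: "c \<in> gauss_ints" "d \<in> gauss_ints" "(c - d) / 2 \<in> gauss_ints"
      and x: "x = (c + d * sqrt_p) / 2"
      using x by (auto simp: ring_of_integers_ext_iff)
    obtain a b where ab: "a \<in> gauss_ints" "b \<in> gauss_ints" "y = a * \<alpha> + b * \<beta>"
      using IE[OF y] by blast
    \<comment> \<open>As x = e + d (1 + sqrt p)/2, closure under Z[i] and under (1 + sqrt p)/2 gives
      closure under the whole ring of integers.\<close>
    let ?e = "(c - d) / 2"
    have "x * y = ?e * y + d * (a * (?\<theta> * \<alpha>) + b * (?\<theta> * \<beta>))"
      by (simp add: x ab(3) field_simps)
    also have "\<dots> = (?e * a + d * (a * of_int A + b * (of_int B * \<i>))) * \<alpha> +
        (?e * b + d * (b * (1 - of_int A) - a * (of_int B * \<i>))) * \<beta>"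
      unfolding half_alpha half_beta by (simp add: ab(3) algebra_simps)
    also have "\<dots> \<in> I"
      by (rule II) (simp_all only: gauss_ints_closed cd ab)
    finally show ?thesis .
  qed
  have ideal: "nonzero_ideal I ext"
    unfolding nonzero_ideal_def
  proof
    show "ideal I (complex_ring\<lparr>carrier := ring_of_integers ext\<rparr>)"
    proof (rule idealI_ring_of_integers[OF I_sub])
      show "0 \<in> I" using II[of 0 0] by simp
      fix x y assume "x \<in> I" "y \<in> I"
      then obtain a b c d where "a \<in> gauss_ints" "b \<in> gauss_ints" "x = a * \<alpha> + b * \<beta>"
        "c \<in> gauss_ints" "d \<in> gauss_ints" "y = c * \<alpha> + d * \<beta>" using IE by meson
      thus "x + y \<in> I" using II[of "a + c" "b + d"] by (simp add: algebra_simps)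
    qed (rule I_mult)
    have "\<alpha> \<in> I" using II[of 1 0] by simp
    moreover have "\<alpha> \<noteq> 0" using indep[of 1 0] by auto
    ultimately show "I \<noteq> {0}" by blast
  qed
  have basis: "integral_basis Q_i.ext 2 \<nu> I"
    unfolding integral_basis_def ring_of_integers_Q_ii
  proof (intro conjI allI impI)
    show "I = {\<Sum>k<2. a k * \<nu> k | a. \<forall>k<2. a k \<in> gauss_ints}"
    proof (intro equalityI subsetI)
      fix x assume "x \<in> I"
      then obtain a b where ab: "a \<in> gauss_ints" "b \<in> gauss_ints" "x = a * \<alpha> + b * \<beta>"
        using IE by blast
      have "x = (\<Sum>k<2. (if k = 0 then a else b) * \<nu> k)"
        using ab by (simp add: numeral_2_eq_2 nu)
      moreover have "\<forall>k<2. (if k = (0::nat) then a else b) \<in> gauss_ints" using ab by simp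
      ultimately show "x \<in> {\<Sum>k<2. a k * \<nu> k | a. \<forall>k<2. a k \<in> gauss_ints}"
        by (intro CollectI exI[of _ "\<lambda>k. if k = 0 then a else b"] conjI)
    qed (auto simp: numeral_2_eq_2 nu intro: II)
  next
    fix a :: "nat \<Rightarrow> complex" and j :: nat
    assume "\<forall>k<2. a k \<in> gauss_ints" "(\<Sum>k<2. a k * \<nu> k) = 0" "j < 2"
    thus "a j = 0"
      using indep[of "a 0" "a 1"] by (auto simp: numeral_2_eq_2 nu less_Suc_eq)
  qed
  have layer: "layer_element 2 \<nu> u l = u (l, 0) * \<alpha> + u (l, 1) * \<beta>" for u l
    by (simp add: layer_element_2 nu)
  have info: "u (l, j) \<in> gauss_ints" if "u \<in> info_symbols Q_i.ext 2" "l < 2" "j < 2" for u l j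
    using that by (auto simp: info_symbols_def ring_of_integers_Q_ii PiE_iff)
  have p_real: "real p > 0" using p_pos by simp
  have full: "full_rate Q_i.ext 2 conj \<i> \<nu> (real p)"
    unfolding full_rate_def
  proof (rule inj_onI)
    fix u w assume u: "u \<in> info_symbols Q_i.ext 2" and w: "w \<in> info_symbols Q_i.ext 2"
      and eq: "codeword 2 conj \<i> \<nu> (real p) u = codeword 2 conj \<i> \<nu> (real p) w"
    \<comment> \<open>The top row of a codeword shows both layer elements without conjugation,
      scaled by a nonzero constant.\<close>
    have "layer_element 2 \<nu> u l = layer_element 2 \<nu> w l" if "l < 2" for l
    proof -
      have "codeword 2 conj \<i> \<nu> (real p) u $$ (0, l) = codeword 2 conj \<i> \<nu> (real p) w $$ (0, l)"
        by (simp only: eq)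
      thus ?thesis using that p_pos by (simp add: codeword_2)
    qed
    hence "(u (l, 0) - w (l, 0)) * \<alpha> + (u (l, 1) - w (l, 1)) * \<beta> = 0" if "l < 2" for l
      using that by (simp add: layer algebra_simps)
    hence "u (l, 0) - w (l, 0) = 0 \<and> u (l, 1) - w (l, 1) = 0" if "l < 2" for l
      using that info[OF u that] info[OF w that] by (intro indep) auto
    hence "u (l, j) = w (l, j)" if "l < 2" "j < 2" for l j
      using that less_2_cases[of j] by auto
    thus "u = w"
      using u w unfolding info_symbols_def by (intro PiE_ext[OF u[unfolded info_symbols_def] w[unfolded info_symbols_def]]) auto
  qed
  have nonvanishing: "nonvanishing_det Q_i.ext 2 conj \<i> \<nu> (real p)"
    unfolding nonvanishing_det_def
  \<comment> \<open>The determinant is D / p with D a nonzero Gaussian integer, whence this value of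
    \<delta>.\<close>
  proof (intro exI[of _ "1 / (real p)\<^sup>2"] conjI ballI impI)
    show "1 / (real p)\<^sup>2 > 0" using p_pos by simp
    fix M assume "M \<in> infinite_code Q_i.ext 2 conj \<i> \<nu> (real p)" and M0: "M \<noteq> 0\<^sub>m 2 2"
    then obtain u where u: "u \<in> info_symbols Q_i.ext 2" and M: "M = codeword 2 conj \<i> \<nu> (real p) u"
      by (auto simp: infinite_code_def)
    define x where "x = (\<lambda>l. layer_element 2 \<nu> u l)"
    have "x l \<in> I" if "l < 2" for l
      unfolding x_def layer using info[OF u that] by (intro II) auto
    hence xO: "x l \<in> ring_of_integers ext" if "l < 2" for l
      using that I_sub by blast
    define D where "D = x 0 * conj (x 0) - \<i> * (x 1 * conj (x 1))"
    have detM: "det M = D / of_nat p"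
      unfolding M det_codeword_2[OF p_real] D_def x_def by simp
    have "D \<noteq> 0"
    proof
      assume "D = 0"
      hence "x 0 = 0 \<and> x 1 = 0"
        using norm_nonzero[OF xO xO, of 0 1] by (simp add: D_def)
      hence "layer_element 2 \<nu> u l = 0" if "l < 2" for l
        using that less_2_cases[of l] by (auto simp: x_def)
      hence "M = 0\<^sub>m 2 2"
        using conj_base[of 0] unfolding M codeword_2 by (intro eq_matI) auto
      with M0 show False by simp
    qed
    moreover have "D \<in> gauss_ints"
      unfolding D_def using norm_in_gauss_ints xO by simp
    ultimately have "cmod D \<ge> 1" by (intro cmod_gauss_int_ge_1)
    hence "1 \<le> (cmod D)\<^sup>2" by (simp add: one_le_power)
    thus "(cmod (det M))\<^sup>2 \<ge> 1 / (real p)\<^sup>2"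
      using p_pos by (simp add: detM norm_divide power_divide divide_right_mono)
  qed
  have unitary: "unitary_mat 2 (layer_matrix 2 conj \<nu> (real p))"
  proof -
    let ?R = "layer_matrix 2 conj \<nu> (real p)"
    have R: "?R \<in> carrier_mat 2 2" by (simp add: layer_matrix_def)
    have entry: "?R $$ (i, j) = (if i = j then \<alpha> else \<beta>) / sqrt_p" if "i < 2" "j < 2" for i j
      using that less_2_cases[of i] less_2_cases[of j]
      by (auto simp: layer_matrix_def nu conj_alpha conj_beta)
    \<comment> \<open>As sqrt p is real, the two sums are (|\<pi>|^2 + p)/2 and (|\<pi>|^2 - p)/2;
      the choice |\<pi>|^2 = p makes the rows orthogonal.\<close>
    have norms: "\<alpha> * cnj \<alpha> + \<beta> * cnj \<beta> = of_nat p" "\<alpha> * cnj \<beta> + \<beta> * cnj \<alpha> = 0"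
    proof -
      have "\<alpha> * cnj \<alpha> + \<beta> * cnj \<beta> = (\<pi> * cnj \<pi> + sqrt_p * sqrt_p) / 2"
        by (simp add: \<alpha>_def \<beta>_def field_simps)
      thus "\<alpha> * cnj \<alpha> + \<beta> * cnj \<beta> = of_nat p" by (simp add: pi_norm sqrt_p_square)
      have "\<alpha> * cnj \<beta> + \<beta> * cnj \<alpha> = (\<pi> * cnj \<pi> - sqrt_p * sqrt_p) / 2"
        by (simp add: \<alpha>_def \<beta>_def field_simps)
      thus "\<alpha> * cnj \<beta> + \<beta> * cnj \<alpha> = 0" by (simp add: pi_norm sqrt_p_square)
    qed
    have "?R * mat_adjoint ?R = 1\<^sub>m 2"
    proof (rule eq_matI)
      fix i j assume "i < dim_row (1\<^sub>m 2 :: complex mat)" "j < dim_col (1\<^sub>m 2 :: complex mat)"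
      hence ij: "i < 2" "j < 2" by simp_all
      have "(?R * mat_adjoint ?R) $$ (i, j) = (\<Sum>k<2. ?R $$ (i, k) * cnj (?R $$ (j, k)))"
        using ij R mat_adjoint_carrier[OF R] mat_adjoint_index[OF R]
        by (simp add: scalar_prod_def atLeast0LessThan)
      also have "\<dots> = ?R $$ (i, 0) * cnj (?R $$ (j, 0)) + ?R $$ (i, 1) * cnj (?R $$ (j, 1))"
        by (simp add: numeral_2_eq_2)
      also have "\<dots> = (if i = j then \<alpha> * cnj \<alpha> + \<beta> * cnj \<beta> else \<alpha> * cnj \<beta> + \<beta> * cnj \<alpha>) / (sqrt_p * sqrt_p)"
        using ij less_2_cases[of i] less_2_cases[of j]
        by (auto simp: entry add_divide_distrib)
      also have "\<dots> = 1\<^sub>m 2 $$ (i, j)"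
        unfolding norms sqrt_p_square using ij p_pos by simp
      finally show "(?R * mat_adjoint ?R) $$ (i, j) = 1\<^sub>m 2 $$ (i, j)" .
    qed (use R mat_adjoint_carrier[OF R] in auto)
    moreover from this have "mat_adjoint ?R * ?R = 1\<^sub>m 2"
      using mat_mult_left_right_inverse[OF R mat_adjoint_carrier[OF R]] by blast
    ultimately show ?thesis using R by (simp add: unitary_mat_def)
  qed
  show ?thesis
    using ideal basis full nonvanishing unitary by (auto simp: perfect_code_def)
qed

end

theorem mainTheorem1:
  fixes p :: nat and F K :: "complex set" and \<gamma> :: complex
  assumes "prime p" and "p mod 8 = 5"
    and "F = Q_adjoin {\<i>}"
    and "K = Q_adjoin {\<i>, complex_of_real (sqrt (real p))}"
    and "\<gamma> = \<i>"
  shows "(\<exists>!\<sigma>. galois_generator F K \<sigma> \<and>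
            \<sigma> (complex_of_real (sqrt (real p))) = - complex_of_real (sqrt (real p))) \<and>
         (\<forall>\<sigma>. galois_generator F K \<sigma> \<and>
            \<sigma> (complex_of_real (sqrt (real p))) = - complex_of_real (sqrt (real p)) \<longrightarrow>
            code_setting F K 2 \<sigma> \<gamma> (real p) \<and>
            (\<exists>I \<nu>. nonzero_ideal I K \<and> integral_basis F 2 \<nu> I \<and>
                   perfect_code F 2 \<sigma> \<gamma> \<nu> (real p)))"
proof -
  interpret prime_5_mod_8 p using assms by unfold_locales
  have F: "F = Q_i.ext" using assms(3) Q_adjoin_ii by simp
  have K: "K = ext" using assms(4) Q_adjoin_ii_sqrt_p by simp
  \<comment> \<open>There is only one generator, so the uniqueness of \<sigma> and the claim for
    every such \<sigma> both reduce to \<open>conj\<close>.\<close>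
  have gen: "galois_generator F K \<sigma> \<longleftrightarrow> \<sigma> = conj" for \<sigma>
    unfolding F K by (rule galois_generator_iff)
  have "code_setting F K 2 conj \<gamma> (real p)"
    using cyclic_extension_ext galois_generator_iff assms(3) p_pos Q_i.s_in_ext
    by (simp add: code_setting_def F K assms(5) Q_adjoin_ii)
  thus ?thesis
    unfolding gen using conj_s perfect_code_exists
    by (auto simp: F K assms(5))
qed

end
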